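(* For every morphism $f\colon \mathrm{FP}(E)\to \mathrm{FP}(F)$ in $\mathsf{RMIPG}$, the formulas $\varphi_f(0)=0$ and $\varphi_f(\alpha,\beta)=(f(\alpha),f(\beta))$ define a regular extended path homomorphism $\varphi_f\colon S(E)\to S(F)$, and the assignment $f\mapsto\varphi_f$ (identity on objects) renders $\mathsf{RMIPG}$ a subcategory of $\mathsf{REG}$, i.e. it is a functor $\mathsf{RMIPG}\to\mathsf{REG}$ that is injective on objects and faithful.
   Context: A graph $E=(E^0,E^1,s_E,t_E)$ consists of arbitrary sets $E^0$ (vertices), $E^1$ (edges) and maps $s_E,t_E\colon E^1\to E^0$. A vertex $v$ is regular if $s_E^{-1}(v)$ is finite and nonempty; $\mathrm{reg}(E)$ is the set of regular vertices, and $\mathrm{reg}_0(E)=\{v\in\mathrm{reg}(E)\mid s_E^{-1}(v)=\{e\}\text{ and }t_E(e)=v\}$. $\mathrm{FP}(E)$ is the set of finite paths: vertices (length $0$) and sequences $e_1\ldots e_n$ of edges with $t_E(e_i)=s_E(e_{i+1})$; source and target extend to paths, and vertices act as units for concatenation. Write $\alpha\preceq\beta$ if $\beta=\alpha\gamma$ for some path $\gamma$. A path homomorphism from $E$ to $F$ is a map $f\colon \mathrm{FP}(E)\to\mathrm{FP}(F)$ with $f(E^0)\subseteq F^0$, commuting with source and target, and with $f(pq)=f(p)f(q)$ whenever $t_E(p)=s_E(q)$. It is monotonic if for edges $e,e'\in E^1$, $f(e)\preceq f(e')$ implies $e=e'$. For $v\in\mathrm{reg}(E)$ consider the condition $(\ast_v)$: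 (a) $f$ is injective on $s_E^{-1}(v)$; and (b) a path $p$ in $F$ lies in $f(s_E^{-1}(v))$ if and only if (i) $p=e_1\ldots e_n$ with $n\ge1$ and all $e_i\in F^1$, (ii) $pq\in f(s_E^{-1}(v))$ implies $q=t_F(p)$, and (iii) for all $i\in\{1,\ldots,n\}$ and $e\in s_F^{-1}(s_F(e_i))$ there is $r\in\mathrm{FP}(F)$ with $e_1\ldots e_{i-1}er\in f(s_E^{-1}(v))$. The path homomorphism $f$ is regular if $(\ast_v)$ holds for every $v\in\mathrm{reg}(E)\setminus\mathrm{reg}_0(E)$ and, for every $v\in\mathrm{reg}_0(E)$, either $(\ast_v)$ holds or $f(s_E^{-1}(v))=\{f(v)\}$. $\mathsf{RMIPG}$ is the category of graphs and regular monotonic path homomorphisms that are injective on vertices. The graph inverse semigroup is $S(E)=\{(\alpha,\beta)\in \mathrm{FP}(E)^2\mid t_E(\alpha)=t_E(\beta)\}\cup\{0\}$ with $(\alpha,\beta)(\gamma,\delta)=(\alpha\gamma',\delta)$ if $\gamma=\beta\gamma'$, $=(\alpha,\delta\beta')$ if $\beta=\gamma\beta'$, and $=0$ otherwise; $0$ is a zero element. It is an inverse semigroup with $(\alpha,\beta)^*=(\beta,\alpha)$ and natural order $s\le t\iff ss^*t=s$. An extended path homomorphism from $E$ to $F$ is a semigroup homomorphism $\varphi\colon S(E)\to S(F)$ with $\varphi(0)=0$; it is regular if whenever $u\in\mathrm{reg}(E)$, $0\ne t\in S(F)$ and $t\le\varphi(u,u)$, there exists $e\in s_E^{-1}(u)$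 with $t\varphi(e,e)\neq0$. $\mathsf{REG}$ is the category of graphs and regular extended path homomorphisms, with composition of maps. *)

theory Defs
  imports "Graph_Theory.Arc_Walk" "HOL-Library.FuncSet"
begin

text \<open>
  A graph is a \<^term>\<open>wf_digraph\<close>: arbitrary sets \<^term>\<open>verts E\<close> and \<^term>\<open>arcs E\<close>, with source map
  \<^term>\<open>tail E\<close> and target map \<^term>\<open>head E\<close>. No finiteness is assumed.
\<close>

definition reg :: "('v, 'e) pre_digraph \<Rightarrow> 'v set" where
  "reg E = {v \<in> verts E. finite (out_arcs E v) \<and> out_arcs E v \<noteq> {}}"

definition reg0 :: "('v, 'e) pre_digraph \<Rightarrow> 'v set" where
  "reg0 E = {v \<in> reg E. \<exists>e. out_arcs E v = {e} \<and> head E e = v}"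


section \<open>Finite paths\<close>

text \<open>
  A finite path is encoded by its source together with its list of edges, so that the vertex
  \<open>v\<close>, as a path of length zero, is \<open>(v, [])\<close> and the edge \<open>e\<close> is \<open>(tail E e, [e])\<close>.
\<close>

type_synonym ('v, 'e) path = "'v \<times> 'e list"

definition FP :: "('v, 'e) pre_digraph \<Rightarrow> ('v, 'e) path set" where
  "FP E = {(u, es). \<exists>v. pre_digraph.awalk E u es v}"

definition vpath :: "'v \<Rightarrow> ('v, 'e) path" where
  "vpath v = (v, [])"

definition epath :: "('v, 'e) pre_digraph \<Rightarrow> 'e \<Rightarrow> ('v, 'e) path" where
  "epath E e = (tail E e, [e])"

definition psrc :: "('v, 'e) path \<Rightarrow> 'v" where
  "psrc p = fst p"

definition ptgt :: "('v, 'e) pre_digraph \<Rightarrow> ('v, 'e) path \<Rightarrow> 'v" where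
  "ptgt E p = last (pre_digraph.awalk_verts E (fst p) (snd p))"

text \<open>Concatenation is only meaningful if the target of \<open>p\<close> is the source of \<open>q\<close>.\<close>

definition pconc :: "('v, 'e) path \<Rightarrow> ('v, 'e) path \<Rightarrow> ('v, 'e) path" where
  "pconc p q = (fst p, snd p @ snd q)"

text \<open>\<open>extends_by E \<alpha> \<gamma> \<beta>\<close> states that \<open>\<beta> = \<alpha>\<gamma>\<close> for a path \<open>\<gamma>\<close> composable with \<open>\<alpha>\<close>.\<close>

definition extends_by ::
    "('v, 'e) pre_digraph \<Rightarrow> ('v, 'e) path \<Rightarrow> ('v, 'e) path \<Rightarrow> ('v, 'e) path \<Rightarrow> bool" where
  "extends_by E \<alpha> \<gamma> \<beta> \<longleftrightarrow> \<gamma> \<in> FP E \<and> ptgt E \<alpha> = psrc \<gamma> \<and> \<beta> = pconc \<alpha> \<gamma>"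

definition path_le :: "('v, 'e) pre_digraph \<Rightarrow> ('v, 'e) path \<Rightarrow> ('v, 'e) path \<Rightarrow> bool" where
  "path_le E \<alpha> \<beta> \<longleftrightarrow> (\<exists>\<gamma>. extends_by E \<alpha> \<gamma> \<beta>)"


section \<open>Path homomorphisms\<close>

text \<open>
  Maps on paths, and below maps on graph inverse semigroups, are taken to be extensional, so that
  HOL equality is equality of maps on their domain.
\<close>

definition path_hom ::
    "('v, 'e) pre_digraph \<Rightarrow> ('w, 'f) pre_digraph \<Rightarrow> (('v, 'e) path \<Rightarrow> ('w, 'f) path) \<Rightarrow> bool" where
  "path_hom E F f \<longleftrightarrow>
     f \<in> FP E \<rightarrow>\<^sub>E FP F \<and>
     f ` vpath ` verts E \<subseteq> vpath ` verts F \<and>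
     (\<forall>p\<in>FP E. f (vpath (psrc p)) = vpath (psrc (f p))) \<and>
     (\<forall>p\<in>FP E. f (vpath (ptgt E p)) = vpath (ptgt F (f p))) \<and>
     (\<forall>p\<in>FP E. \<forall>q\<in>FP E. ptgt E p = psrc q \<longrightarrow> f (pconc p q) = pconc (f p) (f q))"

definition monotonic ::
    "('v, 'e) pre_digraph \<Rightarrow> ('w, 'f) pre_digraph \<Rightarrow> (('v, 'e) path \<Rightarrow> ('w, 'f) path) \<Rightarrow> bool" where
  "monotonic E F f \<longleftrightarrow>
     (\<forall>e\<in>arcs E. \<forall>e'\<in>arcs E. path_le F (f (epath E e)) (f (epath E e')) \<longrightarrow> e = e')"

text \<open>
  Edges of a path are numbered from zero here, so the prefix \<open>e\<^sub>1 \<dots> e\<^sub>i\<^sub>-\<^sub>1\<close> of the usual notation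
  consists of the edges \<open>take i (snd p)\<close>.
\<close>

definition reg_at ::
    "('v, 'e) pre_digraph \<Rightarrow> ('w, 'f) pre_digraph \<Rightarrow> (('v, 'e) path \<Rightarrow> ('w, 'f) path) \<Rightarrow> 'v \<Rightarrow> bool" where
  "reg_at E F f v \<longleftrightarrow>
     inj_on (\<lambda>e. f (epath E e)) (out_arcs E v) \<and>
     (let A = f ` epath E ` out_arcs E v in
      \<forall>p\<in>FP F. p \<in> A \<longleftrightarrow>
        snd p \<noteq> [] \<and>
        (\<forall>q\<in>FP F. ptgt F p = psrc q \<longrightarrow> pconc p q \<in> A \<longrightarrow> q = vpath (ptgt F p)) \<and>
        (\<forall>i<length (snd p). \<forall>e\<in>out_arcs F (tail F (snd p ! i)).
           \<exists>r\<in>FP F. psrc r = head F e \<and>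
             pconc (psrc p, take i (snd p) @ [e]) r \<in> A))"

definition regular_path_hom ::
    "('v, 'e) pre_digraph \<Rightarrow> ('w, 'f) pre_digraph \<Rightarrow> (('v, 'e) path \<Rightarrow> ('w, 'f) path) \<Rightarrow> bool" where
  "regular_path_hom E F f \<longleftrightarrow>
     path_hom E F f \<and>
     (\<forall>v \<in> reg E - reg0 E. reg_at E F f v) \<and>
     (\<forall>v \<in> reg0 E. reg_at E F f v \<or> f ` epath E ` out_arcs E v = {f (vpath v)})"

definition RMIPG_hom ::
    "('v, 'e) pre_digraph \<Rightarrow> ('w, 'f) pre_digraph \<Rightarrow> (('v, 'e) path \<Rightarrow> ('w, 'f) path) set" where
  "RMIPG_hom E F =
     {f. regular_path_hom E F f \<and> monotonic E F f \<and> inj_on f (vpath ` verts E)}"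


section \<open>Graph inverse semigroups\<close>

text \<open>The zero element is \<^term>\<open>None\<close>.\<close>

type_synonym ('v, 'e) gis = "(('v, 'e) path \<times> ('v, 'e) path) option"

definition gis :: "('v, 'e) pre_digraph \<Rightarrow> ('v, 'e) gis set" where
  "gis E = Some ` {(\<alpha>, \<beta>). \<alpha> \<in> FP E \<and> \<beta> \<in> FP E \<and> ptgt E \<alpha> = ptgt E \<beta>} \<union> {None}"

text \<open>
  If \<open>\<beta>\<close> is a prefix of \<open>\<gamma>\<close>, the path \<open>\<gamma>'\<close> with \<open>\<gamma> = \<beta>\<gamma>'\<close> is unique. If each of \<open>\<beta>\<close>, \<open>\<gamma>\<close> is a
  prefix of the other, then they are equal and the first two cases agree.
\<close>

definition gis_mult ::
    "('v, 'e) pre_digraph \<Rightarrow> ('v, 'e) gis \<Rightarrow> ('v, 'e) gis \<Rightarrow> ('v, 'e) gis" where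
  "gis_mult E s t =
     (case (s, t) of
        (Some (\<alpha>, \<beta>), Some (\<gamma>, \<delta>)) \<Rightarrow>
          if path_le E \<beta> \<gamma> then Some (pconc \<alpha> (THE \<gamma>'. extends_by E \<beta> \<gamma>' \<gamma>), \<delta>)
          else if path_le E \<gamma> \<beta> then Some (\<alpha>, pconc \<delta> (THE \<beta>'. extends_by E \<gamma> \<beta>' \<beta>))
          else None
      | _ \<Rightarrow> None)"

definition gis_star :: "('v, 'e) gis \<Rightarrow> ('v, 'e) gis" where
  "gis_star s = map_option (\<lambda>(\<alpha>, \<beta>). (\<beta>, \<alpha>)) s"

definition gis_le :: "('v, 'e) pre_digraph \<Rightarrow> ('v, 'e) gis \<Rightarrow> ('v, 'e) gis \<Rightarrow> bool" where
  "gis_le E s t \<longleftrightarrow> gis_mult E (gis_mult E s (gis_star s)) t = s"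

definition ext_path_hom ::
    "('v, 'e) pre_digraph \<Rightarrow> ('w, 'f) pre_digraph \<Rightarrow> (('v, 'e) gis \<Rightarrow> ('w, 'f) gis) \<Rightarrow> bool" where
  "ext_path_hom E F \<phi> \<longleftrightarrow>
     \<phi> \<in> gis E \<rightarrow>\<^sub>E gis F \<and>
     (\<forall>s\<in>gis E. \<forall>t\<in>gis E. \<phi> (gis_mult E s t) = gis_mult F (\<phi> s) (\<phi> t)) \<and>
     \<phi> None = None"

definition REG_hom ::
    "('v, 'e) pre_digraph \<Rightarrow> ('w, 'f) pre_digraph \<Rightarrow> (('v, 'e) gis \<Rightarrow> ('w, 'f) gis) set" where
  "REG_hom E F =
     {\<phi>. ext_path_hom E F \<phi> \<and>
         (\<forall>u\<in>reg E. \<forall>t\<in>gis F.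
            t \<noteq> None \<and> gis_le F t (\<phi> (Some (vpath u, vpath u))) \<longrightarrow>
            (\<exists>e\<in>out_arcs E u. gis_mult F t (\<phi> (Some (epath E e, epath E e))) \<noteq> None))}"

definition phi ::
    "('v, 'e) pre_digraph \<Rightarrow> (('v, 'e) path \<Rightarrow> ('w, 'f) path) \<Rightarrow> ('v, 'e) gis \<Rightarrow> ('w, 'f) gis" where
  "phi E f = restrict (\<lambda>s. case s of None \<Rightarrow> None | Some (\<alpha>, \<beta>) \<Rightarrow> Some (f \<alpha>, f \<beta>)) (gis E)"


section \<open>Categories and functors\<close>

text \<open>
  Morphisms are plain HOL functions that do not carry their domain and codomain, so composition
  and the action of a functor on morphisms take the objects involved as arguments.
\<close>

record ('o, 'm) cat =
  Obj :: "'o set"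
  Hom :: "'o \<Rightarrow> 'o \<Rightarrow> 'm set"
  Ident :: "'o \<Rightarrow> 'm"
  Comp :: "'o \<Rightarrow> 'o \<Rightarrow> 'o \<Rightarrow> 'm \<Rightarrow> 'm \<Rightarrow> 'm" \<comment> \<open>\<open>Comp C X Y Z g f\<close> is \<open>g \<circ> f\<close> for \<open>f : X \<rightarrow> Y\<close>, \<open>g : Y \<rightarrow> Z\<close>\<close>

locale category =
  fixes C :: "('o, 'm) cat"
  assumes Ident_in_Hom: "X \<in> Obj C \<Longrightarrow> Ident C X \<in> Hom C X X"
    and Comp_in_Hom: "\<lbrakk>X \<in> Obj C; Y \<in> Obj C; Z \<in> Obj C; f \<in> Hom C X Y; g \<in> Hom C Y Z\<rbrakk>
      \<Longrightarrow> Comp C X Y Z g f \<in> Hom C X Z"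
    and Comp_Ident_right: "\<lbrakk>X \<in> Obj C; Y \<in> Obj C; f \<in> Hom C X Y\<rbrakk>
      \<Longrightarrow> Comp C X X Y f (Ident C X) = f"
    and Comp_Ident_left: "\<lbrakk>X \<in> Obj C; Y \<in> Obj C; f \<in> Hom C X Y\<rbrakk>
      \<Longrightarrow> Comp C X Y Y (Ident C Y) f = f"
    and Comp_assoc: "\<lbrakk>W \<in> Obj C; X \<in> Obj C; Y \<in> Obj C; Z \<in> Obj C;
        f \<in> Hom C W X; g \<in> Hom C X Y; h \<in> Hom C Y Z\<rbrakk>
      \<Longrightarrow> Comp C W Y Z h (Comp C W X Y g f) = Comp C W X Z (Comp C X Y Z h g) f"

locale cat_functor = dom: category C + cod: category D
  for C :: "('o, 'm) cat" and D :: "('p, 'n) cat"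
    and ob :: "'o \<Rightarrow> 'p" and mor :: "'o \<Rightarrow> 'o \<Rightarrow> 'm \<Rightarrow> 'n" +
  assumes ob_in_Obj: "X \<in> Obj C \<Longrightarrow> ob X \<in> Obj D"
    and mor_in_Hom: "\<lbrakk>X \<in> Obj C; Y \<in> Obj C; f \<in> Hom C X Y\<rbrakk> \<Longrightarrow> mor X Y f \<in> Hom D (ob X) (ob Y)"
    and mor_Ident: "X \<in> Obj C \<Longrightarrow> mor X X (Ident C X) = Ident D (ob X)"
    and mor_Comp: "\<lbrakk>X \<in> Obj C; Y \<in> Obj C; Z \<in> Obj C; f \<in> Hom C X Y; g \<in> Hom C Y Z\<rbrakk>
      \<Longrightarrow> mor X Z (Comp C X Y Z g f) = Comp D (ob X) (ob Y) (ob Z) (mor Y Z g) (mor X Y f)"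

definition faithful :: "('o, 'm) cat \<Rightarrow> ('o \<Rightarrow> 'o \<Rightarrow> 'm \<Rightarrow> 'n) \<Rightarrow> bool" where
  "faithful C mor \<longleftrightarrow> (\<forall>X\<in>Obj C. \<forall>Y\<in>Obj C. inj_on (mor X Y) (Hom C X Y))"

text \<open>
  The objects are all graphs with vertices in the type \<open>'v\<close> and edges in the type \<open>'e\<close>; the two
  types are arbitrary and serve as universes.
\<close>

definition RMIPG ::
    "(('v, 'e) pre_digraph, ('v, 'e) path \<Rightarrow> ('v, 'e) path) cat" where
  "RMIPG =
     \<lparr>Obj = {E. wf_digraph E},
      Hom = RMIPG_hom,
      Ident = (\<lambda>E. restrict (\<lambda>p. p) (FP E)),
      Comp = (\<lambda>E F G g f. compose (FP E) g f)\<rparr>"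

definition REG ::
    "(('v, 'e) pre_digraph, ('v, 'e) gis \<Rightarrow> ('v, 'e) gis) cat" where
  "REG =
     \<lparr>Obj = {E. wf_digraph E},
      Hom = REG_hom,
      Ident = (\<lambda>E. restrict (\<lambda>s. s) (gis E)),
      Comp = (\<lambda>E F G \<psi> \<phi>. compose (gis E) \<psi> \<phi>)\<rparr>"

end

theory Submission
  imports Defs "HOL-Library.Sublist"
begin

text \<open>
  A monotonic path homomorphism \<open>f\<close> that is injective on vertices reflects comparability of paths
  under \<open>\<preceq>\<close>, since the first edges of two paths with comparable images coincide and can be
  cancelled. Therefore \<open>\<phi>\<^sub>f\<close> is multiplicative, and such homomorphisms compose. For them, regularity
  amounts to the branching condition, that \<open>(iii)\<close> holds at every regular vertex: \<open>(a)\<close>, \<open>(ii)\<close> and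
  the converse direction of \<open>(b)\<close> are automatic, and an edge mapped to a vertex must be a lone loop
  at a vertex of \<open>reg\<^sub>0(E)\<close>. Branching composes, and it makes \<open>\<phi>\<^sub>f\<close> regular because every path
  leaving \<open>f(u)\<close> is comparable with the image of an edge leaving \<open>u\<close>.
\<close>


section \<open>Paths\<close>

text \<open>Two difficulties lie behind the outline. First, \<open>gis_mult\<close> involves a
  \<open>THE\<close> and an existential over paths. It is replaced by a product
  \<open>\<odot>\<close> that reads everything off edge lists and agrees with it on
  \<open>gis\<close>; being total and associative, it leaves membership conditions only where a
  homomorphism is applied. Second, the target of the functor must itself be a category, so arbitrary
  regular extended path homomorphisms must compose, and these need not come from a map on paths. In
  both categories regularity of the second map speaks only about regular vertices of the middle
  graph, whereas the first map supplies no such vertex directly. The remedy is the same both times: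
  regularity of the first map makes every edge leaving a suitable vertex occur at one fixed position
  in one of finitely many paths, so that vertex emits finitely many edges.\<close>

definition path_prefix :: "('v, 'e) path \<Rightarrow> ('v, 'e) path \<Rightarrow> bool" where
  "path_prefix p q \<longleftrightarrow> fst p = fst q \<and> prefix (snd p) (snd q)"

definition comparable :: "('v, 'e) path \<Rightarrow> ('v, 'e) path \<Rightarrow> bool" where
  "comparable p q \<longleftrightarrow> path_prefix p q \<or> path_prefix q p"

lemma path_prefix_refl [simp]: "path_prefix p p"
  by (simp add: path_prefix_def)

lemma path_prefix_trans: "path_prefix p q \<Longrightarrow> path_prefix q r \<Longrightarrow> path_prefix p r"
  unfolding path_prefix_def by (metis prefix_order.trans)

lemma path_prefix_antisym: "path_prefix p q \<Longrightarrow> path_prefix q p \<Longrightarrow> p = q"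
  unfolding path_prefix_def by (simp add: prefix_order.antisym prod_eq_iff)

lemma path_prefix_length: "path_prefix p q \<Longrightarrow> length (snd p) \<le> length (snd q)"
  by (auto simp: path_prefix_def prefix_length_le)

lemma comparable_commute: "comparable p q \<longleftrightarrow> comparable q p"
  by (auto simp: comparable_def)

lemma prefixes_of_same_comparable:
  "path_prefix p r \<Longrightarrow> path_prefix q r \<Longrightarrow> comparable p q"
  unfolding path_prefix_def comparable_def by (metis prefix_same_cases)

context wf_digraph
begin

lemma FP_iff: "(u, es) \<in> FP G \<longleftrightarrow> awalk u es (ptgt G (u, es))"
  by (auto simp: FP_def ptgt_def)

lemma vpath_FP_iff [simp]: "(u, []) \<in> FP G \<longleftrightarrow> u \<in> verts G"
  by (auto simp: FP_def awalk_Nil_iff)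

lemma Cons_FP_iff:
  "(u, e # es) \<in> FP G \<longleftrightarrow> e \<in> arcs G \<and> u = tail G e \<and> (head G e, es) \<in> FP G"
  by (auto simp: FP_def awalk_Cons_iff)

lemma ptgt_Nil [simp]: "ptgt G (u, []) = u"
  by (simp add: ptgt_def)

lemma ptgt_Cons [simp]: "ptgt G (u, e # es) = ptgt G (head G e, es)"
  by (simp add: ptgt_def)

lemma ptgt_append: "ptgt G (u, es @ fs) = ptgt G (ptgt G (u, es), fs)"
  by (simp add: ptgt_def awlast_append)

lemma append_FP_iff:
  "(u, es @ fs) \<in> FP G \<longleftrightarrow> (u, es) \<in> FP G \<and> (ptgt G (u, es), fs) \<in> FP G"
  unfolding FP_iff by (simp add: ptgt_def awlast_append)

lemma psrc_verts: "p \<in> FP G \<Longrightarrow> psrc p \<in> verts G"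
  by (cases p) (auto simp: FP_iff psrc_def)

lemma ptgt_verts: "p \<in> FP G \<Longrightarrow> ptgt G p \<in> verts G"
  by (cases p) (metis FP_iff awalk_last_in_verts)

lemma vpath_FP: "v \<in> verts G \<Longrightarrow> vpath v \<in> FP G"
  by (simp add: vpath_def)

lemma epath_FP: "e \<in> arcs G \<Longrightarrow> epath G e \<in> FP G"
  by (simp add: epath_def Cons_FP_iff)

lemma pconc_FP:
  "p \<in> FP G \<Longrightarrow> q \<in> FP G \<Longrightarrow> ptgt G p = psrc q \<Longrightarrow> pconc p q \<in> FP G"
  by (cases p, cases q) (auto simp: pconc_def append_FP_iff psrc_def)

text \<open>What remains of a path after a path prefix is a path starting at the target of the
  prefix. It is the only possible \<open>q\<close>, which resolves the \<open>THE\<close> in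
  \<open>gis_mult\<close>.\<close>

lemma extends_by_iff:
  assumes "p \<in> FP G" "r \<in> FP G"
  shows "extends_by G p q r \<longleftrightarrow>
    path_prefix p r \<and> q = (ptgt G p, drop (length (snd p)) (snd r))"
proof (cases p, cases q, cases r)
  fix u es v fs w gs
  assume p: "p = (u, es)" and q: "q = (v, fs)" and r: "r = (w, gs)"
  show ?thesis
    using assms unfolding p q r
    by (auto simp: extends_by_def path_prefix_def prefix_def psrc_def pconc_def append_FP_iff)
qed

lemma path_le_iff:
  "p \<in> FP G \<Longrightarrow> q \<in> FP G \<Longrightarrow> path_le G p q \<longleftrightarrow> path_prefix p q"
  by (simp add: path_le_def extends_by_iff)

lemma path_prefix_FP:
  assumes "path_prefix p q" "q \<in> FP G"
  shows "p \<in> FP G"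
    and "(ptgt G p, drop (length (snd p)) (snd q)) \<in> FP G"
    and "ptgt G (ptgt G p, drop (length (snd p)) (snd q)) = ptgt G q"
    and "pconc p (ptgt G p, drop (length (snd p)) (snd q)) = q"
  using assms
  by (cases p; cases q; auto simp: path_prefix_def prefix_def append_FP_iff ptgt_append pconc_def)+

end


section \<open>The multiplication of graph inverse semigroups\<close>

definition pmult :: "('v, 'e) gis \<Rightarrow> ('v, 'e) gis \<Rightarrow> ('v, 'e) gis" (infixl "\<odot>" 70) where
  "s \<odot> t =
     (case (s, t) of
        (Some (\<alpha>, \<beta>), Some (\<gamma>, \<delta>)) \<Rightarrow>
          if path_prefix \<beta> \<gamma> then Some ((fst \<alpha>, snd \<alpha> @ drop (length (snd \<beta>)) (snd \<gamma>)), \<delta>)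
          else if path_prefix \<gamma> \<beta> then Some (\<alpha>, (fst \<delta>, snd \<delta> @ drop (length (snd \<gamma>)) (snd \<beta>)))
          else None
      | _ \<Rightarrow> None)"

lemma pmult_None [simp]: "None \<odot> t = None" "s \<odot> None = None"
  by (auto simp: pmult_def split: option.splits)

text \<open>
  The product makes sense for arbitrary pairs of lists, and the resulting semigroup acts faithfully
  by the partial maps \<open>\<beta>\<gamma> \<mapsto> \<alpha>\<gamma>\<close>; this reduces associativity to that of composition.
\<close>

definition act :: "('v, 'e) gis \<Rightarrow> ('v, 'e) path \<Rightarrow> ('v, 'e) path option" where
  "act s x =
     (case s of None \<Rightarrow> None
      | Some (\<alpha>, \<beta>) \<Rightarrow>
          if path_prefix \<beta> x then Some (fst \<alpha>, snd \<alpha> @ drop (length (snd \<beta>)) (snd x)) else None)"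

text \<open>For nonzero \<open>s\<close>, the second component is the shortest path at which
  \<open>act s\<close> is defined, and the value there is the first component.\<close>

lemma act_inject:
  assumes "act s = act t"
  shows "s = t"
proof (cases s)
  case None
  \<comment> \<open>A nonzero \<open>t\<close> would be defined at its own second component.\<close>
  have "act t (snd (the t)) = None" using None assms by (simp add: act_def flip: assms)
  then have "t = None" by (cases t) (auto simp: act_def)
  then show ?thesis using None by simp
next
  case (Some a)
  obtain \<alpha> \<beta> where s: "s = Some (\<alpha>, \<beta>)" using Some by (cases a) auto
  have 1: "act s \<beta> = Some \<alpha>" by (simp add: s act_def)
  have "t \<noteq> None"
  proof
    assume "t = None"
    then have "act t \<beta> = None" by (simp add: act_def)
    then show False using 1 assms by simp
  qed
  then obtain \<gamma> \<delta> where t: "t = Some (\<gamma>, \<delta>)" by auto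
  have 2: "act t \<delta> = Some \<gamma>" by (simp add: t act_def)
  have 3: "act t \<beta> = Some \<alpha>" "act s \<delta> = Some \<gamma>" using 1 2 assms by simp_all
  then have "path_prefix \<delta> \<beta>" "path_prefix \<beta> \<delta>"
    by (simp_all add: s t act_def split: if_splits)
  then have "\<beta> = \<delta>" by (metis path_prefix_antisym)
  then show ?thesis using 2 3 s t by simp
qed

lemma act_pmult: "act (s \<odot> t) = act s \<circ>\<^sub>m act t"
proof
  fix x
  show "act (s \<odot> t) x = (act s \<circ>\<^sub>m act t) x"
  proof (cases "s = None \<or> t = None")
    case True
    then show ?thesis by (auto simp: act_def map_comp_def split: option.splits)
  next
    case False
    then obtain a as b bs c cs d ds where s: "s = Some ((a, as), (b, bs))"
      and t: "t = Some ((c, cs), (d, ds))" by auto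
    obtain v xs where x: "x = (v, xs)" by (cases x)
    show ?thesis
    proof (cases "path_prefix (d, ds) x")
      case dx: True
      then obtain ys where xs: "v = d" "xs = ds @ ys"
        by (auto simp: x path_prefix_def prefix_def)
      \<comment> \<open>The condition \<open>zs \<noteq> []\<close> keeps the first two cases
        disjoint, in the order in which \<open>pmult\<close> tests them.\<close>
      consider zs where "b = c" "cs = bs @ zs"
        | zs where "b = c" "bs = cs @ zs" "zs \<noteq> []"
        | "\<not> path_prefix (b, bs) (c, cs)" "\<not> path_prefix (c, cs) (b, bs)"
        by (force simp: path_prefix_def prefix_def)
      then show ?thesis
      proof cases
        case 3
        \<comment> \<open>Otherwise \<open>bs\<close> and \<open>cs\<close> would both be prefixes
          of \<open>cs @ ys\<close>, hence comparable.\<close>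
        then have "\<not> path_prefix (b, bs) (c, cs @ ys)"
          by (auto simp: path_prefix_def) (metis prefixI prefix_same_cases)
        then show ?thesis
          using 3 by (simp add: s t x xs pmult_def act_def path_prefix_def)
      qed (auto simp: s t x xs pmult_def act_def path_prefix_def prefix_def)
    next
      case False
      then have "\<not> path_prefix (d, ds @ zs) x" for zs
        by (auto simp: path_prefix_def prefix_def)
      then show ?thesis
        using False by (auto simp: s t pmult_def act_def)
    qed
  qed
qed

lemma pmult_assoc: "(r \<odot> s) \<odot> t = r \<odot> (s \<odot> t)"
  by (rule act_inject) (simp add: act_pmult map_comp_def fun_eq_iff split: option.split)

definition idem :: "('v, 'e) path \<Rightarrow> ('v, 'e) gis" where
  "idem p = Some (p, p)"

lemma idem_pmult:
  "idem p \<odot> idem q =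
     (if path_prefix p q then idem q else if path_prefix q p then idem p else None)"
  by (auto simp: idem_def pmult_def path_prefix_def prefix_def prod_eq_iff)

lemma idem_pmult_idem [simp]: "idem p \<odot> idem p = idem p"
  by (simp add: idem_pmult)

lemma idem_not_None [simp]: "idem p \<noteq> None" "None \<noteq> idem p"
  by (simp_all add: idem_def)

lemma idem_inject [simp]: "idem p = idem q \<longleftrightarrow> p = q"
  by (simp add: idem_def)

lemma idem_pmult_eq_None_iff [simp]: "idem p \<odot> idem q = None \<longleftrightarrow> \<not> comparable p q"
  by (simp add: idem_pmult comparable_def)

lemma idem_pmult_absorb [simp]: "idem p \<odot> idem q = idem p \<longleftrightarrow> path_prefix q p"
  by (auto simp: idem_pmult dest: path_prefix_antisym)

text \<open>A nonzero square needs comparable components. If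
  \<open>\<alpha> = \<beta>\<gamma>\<close>, the square is
  \<open>(\<alpha>\<gamma>, \<beta>)\<close>, so \<open>\<gamma>\<close> is empty; the other case is
  symmetric.\<close>

lemma idempotent_cases:
  assumes "s \<odot> s = s"
  shows "s = None \<or> (\<exists>p. s = idem p)"
proof (cases s)
  case (Some a)
  obtain \<alpha> \<beta> where s: "s = Some (\<alpha>, \<beta>)" using Some by (cases a) auto
  have "\<alpha> = \<beta>"
    using assms by (cases \<alpha>; cases \<beta>)
      (auto simp: s pmult_def path_prefix_def prefix_def split: if_splits)
  then show ?thesis by (simp add: s idem_def)
qed simp

lemma idempotents_commute:
  assumes "s \<odot> s = s" "t \<odot> t = t"
  shows "s \<odot> t = t \<odot> s"
  using idempotent_cases[OF assms(1)] idempotent_cases[OF assms(2)]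
  by (auto simp: idem_pmult dest: path_prefix_antisym)

lemma gis_star_pmult: "s \<odot> gis_star s = (case s of None \<Rightarrow> None | Some (\<alpha>, \<beta>) \<Rightarrow> idem \<alpha>)"
  by (auto simp: gis_star_def pmult_def idem_def split: option.split)

section \<open>The graph inverse semigroup inside the total product\<close>

context wf_digraph
begin

lemma None_gis [simp]: "None \<in> gis G"
  by (simp add: gis_def)

lemma Some_gis_iff:
  "Some (\<alpha>, \<beta>) \<in> gis G \<longleftrightarrow> \<alpha> \<in> FP G \<and> \<beta> \<in> FP G \<and> ptgt G \<alpha> = ptgt G \<beta>"
  by (auto simp: gis_def)

lemma idem_gis_iff [simp]: "idem p \<in> gis G \<longleftrightarrow> p \<in> FP G"
  by (simp add: idem_def Some_gis_iff)

lemma gis_star_gis: "s \<in> gis G \<Longrightarrow> gis_star s \<in> gis G"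
  by (auto simp: gis_def gis_star_def)

lemma gis_mult_eq_pmult:
  assumes "s \<in> gis G" "t \<in> gis G"
  shows "gis_mult G s t = s \<odot> t"
proof (cases "s = None \<or> t = None")
  case True
  then show ?thesis by (auto simp: gis_mult_def split: option.splits)
next
  case False
  then obtain \<alpha> \<beta> \<gamma> \<delta> where s: "s = Some (\<alpha>, \<beta>)" and t: "t = Some (\<gamma>, \<delta>)" by auto
  have "\<beta> \<in> FP G" "\<gamma> \<in> FP G" using assms by (auto simp: s t Some_gis_iff)
  then show ?thesis
    by (auto simp: s t gis_mult_def pmult_def path_le_iff extends_by_iff pconc_def)
qed

lemma pmult_gis:
  assumes "s \<in> gis G" "t \<in> gis G"
  shows "s \<odot> t \<in> gis G"
proof (cases "s = None \<or> t = None")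
  case True
  then show ?thesis by auto
next
  case False
  then obtain \<alpha> \<beta> \<gamma> \<delta> where s: "s = Some (\<alpha>, \<beta>)" and t: "t = Some (\<gamma>, \<delta>)" by auto
  have gis: "\<alpha> \<in> FP G" "\<beta> \<in> FP G" "ptgt G \<alpha> = ptgt G \<beta>"
    "\<gamma> \<in> FP G" "\<delta> \<in> FP G" "ptgt G \<gamma> = ptgt G \<delta>" using assms by (auto simp: s t Some_gis_iff)
  have comp: "(fst \<alpha>, snd \<alpha> @ drop (length (snd \<beta>)) (snd \<gamma>)) \<in> FP G \<and>
      ptgt G (fst \<alpha>, snd \<alpha> @ drop (length (snd \<beta>)) (snd \<gamma>)) = ptgt G \<gamma>"
    if "path_prefix \<beta> \<gamma>" "\<alpha> \<in> FP G" "\<gamma> \<in> FP G" "ptgt G \<alpha> = ptgt G \<beta>" for \<alpha> \<beta> \<gamma>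
    using path_prefix_FP[OF that(1,3)] that by (cases \<alpha>) (simp add: append_FP_iff ptgt_append)
  show ?thesis
    using comp[of \<beta> \<gamma> \<alpha>] comp[of \<gamma> \<beta> \<delta>] gis by (auto simp: s t pmult_def Some_gis_iff)
qed

lemma gis_le_iff:
  assumes "s \<in> gis G" "t \<in> gis G"
  shows "gis_le G s t \<longleftrightarrow> s \<odot> gis_star s \<odot> t = s"
  using assms by (simp add: gis_le_def gis_mult_eq_pmult gis_star_gis pmult_gis)

text \<open>An element below the idempotent \<open>t\<close> is the product of the commuting
  idempotents \<open>s \<odot> gis_star s\<close> and \<open>t\<close>, hence idempotent.
  Conversely, an idempotent \<open>s\<close> satisfies
  \<open>s \<odot> gis_star s = s\<close>.\<close>

lemma gis_le_idempotent_iff: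
  assumes "s \<in> gis G" "t \<in> gis G" "t \<odot> t = t"
  shows "gis_le G s t \<longleftrightarrow> s \<odot> s = s \<and> s \<odot> t = s"
proof
  let ?i = "s \<odot> gis_star s"
  have i: "?i \<odot> ?i = ?i" by (auto simp: gis_star_pmult split: option.split)
  assume "gis_le G s t"
  then have s: "?i \<odot> t = s" using assms by (simp add: gis_le_iff)
  have "t \<odot> ?i = ?i \<odot> t" using idempotents_commute[OF assms(3) i] .
  then have "s \<odot> s = s"
    by (metis s pmult_assoc i assms(3))
  moreover have "s \<odot> t = s"
    by (metis s pmult_assoc assms(3))
  ultimately show "s \<odot> s = s \<and> s \<odot> t = s" by simp
next
  assume s: "s \<odot> s = s \<and> s \<odot> t = s"
  then have "s \<odot> gis_star s = s"
    using idempotent_cases[of s] by (auto simp: gis_star_pmult) (auto simp: idem_def)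
  then show "gis_le G s t" using s assms by (simp add: gis_le_iff)
qed

end


section \<open>Extended path homomorphisms in terms of the total product\<close>

lemma ext_path_hom_iff:
  assumes "wf_digraph E" "wf_digraph F"
  shows "ext_path_hom E F \<phi> \<longleftrightarrow>
     \<phi> \<in> gis E \<rightarrow>\<^sub>E gis F \<and>
     (\<forall>s\<in>gis E. \<forall>t\<in>gis E. \<phi> (s \<odot> t) = \<phi> s \<odot> \<phi> t) \<and>
     \<phi> None = None"
proof -
  interpret E: wf_digraph E by fact
  interpret F: wf_digraph F by fact
  have "gis_mult E s t = s \<odot> t \<and> gis_mult F (\<phi> s) (\<phi> t) = \<phi> s \<odot> \<phi> t"
    if "\<phi> \<in> gis E \<rightarrow>\<^sub>E gis F" "s \<in> gis E" "t \<in> gis E" for s t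
    using that PiE_mem[OF that(1)] by (simp add: E.gis_mult_eq_pmult F.gis_mult_eq_pmult)
  then have "(\<forall>s\<in>gis E. \<forall>t\<in>gis E. \<phi> (gis_mult E s t) = gis_mult F (\<phi> s) (\<phi> t)) \<longleftrightarrow>
      (\<forall>s\<in>gis E. \<forall>t\<in>gis E. \<phi> (s \<odot> t) = \<phi> s \<odot> \<phi> t)" if "\<phi> \<in> gis E \<rightarrow>\<^sub>E gis F"
    using that by simp
  then show ?thesis unfolding ext_path_hom_def by blast
qed

text \<open>The image of \<open>(u,u)\<close> is idempotent, so the nonzero elements below it are
  idempotents \<open>(p,p)\<close>. Regularity thus becomes a statement about paths
  \<open>p\<close>.\<close>

lemma REG_hom_iff:
  assumes "wf_digraph E" "wf_digraph F"
  shows "\<phi> \<in> REG_hom E F \<longleftrightarrow> ext_path_hom E F \<phi> \<and>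
     (\<forall>u\<in>reg E. \<forall>p\<in>FP F. idem p \<odot> \<phi> (idem (vpath u)) = idem p \<longrightarrow>
        (\<exists>e\<in>out_arcs E u. idem p \<odot> \<phi> (idem (epath E e)) \<noteq> None))"
proof (cases "ext_path_hom E F \<phi>")
  case True
  interpret E: wf_digraph E by fact
  interpret F: wf_digraph F by fact
  have hom: "\<phi> \<in> gis E \<rightarrow>\<^sub>E gis F" "\<And>s t. s \<in> gis E \<Longrightarrow> t \<in> gis E \<Longrightarrow> \<phi> (s \<odot> t) = \<phi> s \<odot> \<phi> t"
    using True by (auto simp: ext_path_hom_iff[OF assms])
  have "(\<forall>t\<in>gis F. t \<noteq> None \<and> gis_le F t (\<phi> (Some (vpath u, vpath u))) \<longrightarrow>
          (\<exists>e\<in>out_arcs E u. gis_mult F t (\<phi> (Some (epath E e, epath E e))) \<noteq> None)) \<longleftrightarrow>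
        (\<forall>p\<in>FP F. idem p \<odot> \<phi> (idem (vpath u)) = idem p \<longrightarrow>
          (\<exists>e\<in>out_arcs E u. idem p \<odot> \<phi> (idem (epath E e)) \<noteq> None))"
    (is "?L \<longleftrightarrow> ?R")
    if "u \<in> reg E" for u
  proof -
    have u: "idem (vpath u) \<in> gis E" using that by (simp add: reg_def E.vpath_FP)
    then have \<phi>u: "\<phi> (idem (vpath u)) \<in> gis F" using hom by auto
    have \<phi>e: "\<phi> (idem (epath E e)) \<in> gis F" if "e \<in> out_arcs E u" for e
      using that hom(1) E.epath_FP[of e] by auto
    have "\<phi> (idem (vpath u)) \<odot> \<phi> (idem (vpath u)) = \<phi> (idem (vpath u))"
      using hom(2)[OF u u] by simp
    note le = F.gis_le_idempotent_iff[OF _ \<phi>u this]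
    have "?L \<longleftrightarrow> (\<forall>t\<in>gis F. t \<noteq> None \<and> t \<odot> t = t \<and> t \<odot> \<phi> (idem (vpath u)) = t \<longrightarrow>
        (\<exists>e\<in>out_arcs E u. t \<odot> \<phi> (idem (epath E e)) \<noteq> None))"
      using le \<phi>e by (simp add: F.gis_mult_eq_pmult flip: idem_def)
    also have "\<dots> \<longleftrightarrow> ?R"
    proof (intro iffI ballI impI)
      fix t
      assume R: ?R and t: "t \<in> gis F" "t \<noteq> None \<and> t \<odot> t = t \<and> t \<odot> \<phi> (idem (vpath u)) = t"
      then obtain p where "t = idem p" using idempotent_cases by blast
      then show "\<exists>e\<in>out_arcs E u. t \<odot> \<phi> (idem (epath E e)) \<noteq> None" using R t by simp
    next
      fix p
      assume "p \<in> FP F" "idem p \<odot> \<phi> (idem (vpath u)) = idem p"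
        and "\<forall>t\<in>gis F. t \<noteq> None \<and> t \<odot> t = t \<and> t \<odot> \<phi> (idem (vpath u)) = t \<longrightarrow>
          (\<exists>e\<in>out_arcs E u. t \<odot> \<phi> (idem (epath E e)) \<noteq> None)"
      from this(3)[rule_format, of "idem p"] this(1,2)
      show "\<exists>e\<in>out_arcs E u. idem p \<odot> \<phi> (idem (epath E e)) \<noteq> None" by simp
    qed
    finally show ?thesis .
  qed
  then show ?thesis using True by (auto simp: REG_hom_def)
qed (simp add: REG_hom_def)


section \<open>Path homomorphisms\<close>

locale path_homomorphism = E: wf_digraph E + F: wf_digraph F
  for E :: "('v, 'e) pre_digraph" and F :: "('w, 'f) pre_digraph" +
  fixes f :: "('v, 'e) path \<Rightarrow> ('w, 'f) path"
  assumes hom: "path_hom E F f"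
begin

lemma FP: "p \<in> FP E \<Longrightarrow> f p \<in> FP F"
  using hom by (auto simp: path_hom_def)

lemma vpath_psrc: "p \<in> FP E \<Longrightarrow> vpath (psrc (f p)) = f (vpath (psrc p))"
  using hom by (simp add: path_hom_def)

lemma vpath_ptgt: "p \<in> FP E \<Longrightarrow> vpath (ptgt F (f p)) = f (vpath (ptgt E p))"
  using hom by (simp add: path_hom_def)

lemma snd_Nil: "v \<in> verts E \<Longrightarrow> snd (f (v, [])) = []"
  using hom by (fastforce simp: path_hom_def vpath_def)

lemma append:
  assumes "(u, es @ fs) \<in> FP E"
  shows "f (u, es @ fs) = pconc (f (u, es)) (f (ptgt E (u, es), fs))"
proof -
  have "(u, es) \<in> FP E" "(ptgt E (u, es), fs) \<in> FP E"
    using assms by (simp_all add: E.append_FP_iff)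
  then have "f (pconc (u, es) (ptgt E (u, es), fs)) = pconc (f (u, es)) (f (ptgt E (u, es), fs))"
    using hom by (simp add: path_hom_def psrc_def)
  then show ?thesis by (simp add: pconc_def)
qed

lemma edge_append:
  assumes "(u, e # es) \<in> FP E"
  shows "f (u, e # es) = pconc (f (epath E e)) (f (head E e, es))"
  using append[of u "[e]" es] assms by (simp add: epath_def E.Cons_FP_iff)

lemma fst_eq_iff:
  "p \<in> FP E \<Longrightarrow> q \<in> FP E \<Longrightarrow> fst (f p) = fst (f q) \<longleftrightarrow> f (vpath (fst p)) = f (vpath (fst q))"
  using vpath_psrc[of p] vpath_psrc[of q] by (metis psrc_def vpath_def prod.inject)

lemma ptgt_eq: "p \<in> FP E \<Longrightarrow> q \<in> FP E \<Longrightarrow> ptgt E p = ptgt E q \<Longrightarrow> ptgt F (f p) = ptgt F (f q)"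
  using vpath_ptgt[of p] vpath_ptgt[of q] by (metis vpath_def prod.inject)

lemma path_prefix:
  assumes "path_prefix p q" "q \<in> FP E"
  shows "path_prefix (f p) (f q)"
proof -
  obtain u es fs where "p = (u, es)" "q = (u, es @ fs)"
    using assms(1) by (cases p; cases q) (auto simp: path_prefix_def prefix_def)
  then show ?thesis using append[of u es fs] assms by (simp add: path_prefix_def pconc_def)
qed

lemma drop:
  assumes "path_prefix p q" "q \<in> FP E"
  shows "drop (length (snd (f p))) (snd (f q)) = snd (f (ptgt E p, drop (length (snd p)) (snd q)))"
proof -
  obtain u es fs where "p = (u, es)" "q = (u, es @ fs)"
    using assms(1) by (cases p; cases q) (auto simp: path_prefix_def prefix_def)
  then show ?thesis using append[of u es fs] assms by (simp add: pconc_def)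
qed

end

locale mono_path_homomorphism = path_homomorphism +
  assumes mono: "monotonic E F f" and inj: "inj_on f (vpath ` verts E)"
begin

lemma f_vpath_inject:
  "u \<in> verts E \<Longrightarrow> v \<in> verts E \<Longrightarrow> f (vpath u) = f (vpath v) \<longleftrightarrow> u = v"
  using inj by (auto simp: inj_on_def vpath_def)

lemma fst_inject: "p \<in> FP E \<Longrightarrow> q \<in> FP E \<Longrightarrow> fst (f p) = fst (f q) \<longleftrightarrow> fst p = fst q"
  by (metis fst_eq_iff f_vpath_inject E.psrc_verts psrc_def)

lemma edge_eq:
  assumes "e \<in> arcs E" "d \<in> arcs E" "path_prefix (f (epath E e)) (f (epath E d))"
  shows "e = d"
  using assms mono by (simp add: monotonic_def F.path_le_iff FP E.epath_FP)

lemma edge_eq_comparable: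
  "e \<in> arcs E \<Longrightarrow> d \<in> arcs E \<Longrightarrow> comparable (f (epath E e)) (f (epath E d)) \<Longrightarrow> e = d"
  using edge_eq by (auto simp: comparable_def)

lemma comparable_reflect:
  assumes "p \<in> FP E" "q \<in> FP E" "comparable (f p) (f q)"
  shows "comparable p q"
proof -
  have "(u, es) \<in> FP E \<Longrightarrow> (u, ds) \<in> FP E \<Longrightarrow> comparable (f (u, es)) (f (u, ds)) \<Longrightarrow>
    comparable (u, es) (u, ds)" for u es ds
  proof (induction es arbitrary: u ds)
    case Nil
    then show ?case by (simp add: comparable_def path_prefix_def)
  next
    case (Cons e es)
    show ?case
    proof (cases ds)
      case Nil
      then show ?thesis by (simp add: comparable_def path_prefix_def)
    next
      case ds: (Cons d ds')
      have e: "e \<in> arcs E" "(head E e, es) \<in> FP E" "tail E e = u"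
        and d: "d \<in> arcs E" "(head E d, ds') \<in> FP E" "tail E d = u"
        using Cons.prems ds by (auto simp: E.Cons_FP_iff)
      note eqs = edge_append[OF Cons.prems(1)] edge_append[OF Cons.prems(2)[unfolded ds]]
      have "path_prefix (f (epath E e)) (f (u, e # es))" "path_prefix (f (epath E d)) (f (u, ds))"
        unfolding ds eqs by (simp_all add: path_prefix_def pconc_def)
      \<comment> \<open>The longer of the two comparable images has both edge images as
        prefixes.\<close>
      with Cons.prems(3) have "comparable (f (epath E e)) (f (epath E d))"
        unfolding comparable_def by (meson comparable_def path_prefix_trans prefixes_of_same_comparable)
      then have "e = d" using edge_eq_comparable e d by blast
      moreover have "comparable (f (head E e, es)) (f (head E e, ds'))"
      proof -
        have "comparable (pconc (f (epath E e)) (f (head E e, es)))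
            (pconc (f (epath E e)) (f (head E e, ds')))"
          using Cons.prems(3) eqs unfolding ds \<open>e = d\<close> by simp
        \<comment> \<open>\<open>pconc\<close> forgets the source of its second factor, so
          cancellation compares only edge lists and the sources must be matched separately.\<close>
        moreover have "fst (f (head E e, es)) = fst (f (head E e, ds'))"
          using fst_inject[OF e(2) d(2)] e(2) d(2) \<open>e = d\<close> by simp
        ultimately show ?thesis by (simp add: comparable_def path_prefix_def pconc_def)
      qed
      ultimately show ?thesis
        using Cons.IH e d ds by (fastforce simp: comparable_def path_prefix_def)
    qed
  qed
  \<comment> \<open>Comparable images share their source, and injectivity on vertices lifts this to
    \<open>p\<close> and \<open>q\<close>.\<close>
  moreover have "fst p = fst q"
    using assms by (auto simp: comparable_def path_prefix_def fst_inject)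
  ultimately show ?thesis using assms by (metis prod.collapse)
qed

lemma comparable_iff:
  "p \<in> FP E \<Longrightarrow> q \<in> FP E \<Longrightarrow> comparable (f p) (f q) \<longleftrightarrow> comparable p q"
  by (metis comparable_def comparable_reflect path_prefix)

end


section \<open>Regular path homomorphisms\<close>

text \<open>This is \<open>(iii)\<close> with the path \<open>r\<close> absorbed into a prefix
  relation of edge lists. It holds vacuously for an edge with empty image, which lets collapsed
  loops and other edges be treated uniformly.\<close>

definition branching ::
    "('v, 'e) pre_digraph \<Rightarrow> ('w, 'f) pre_digraph \<Rightarrow> (('v, 'e) path \<Rightarrow> ('w, 'f) path) \<Rightarrow> bool" where
  "branching E F f \<longleftrightarrow>
     (\<forall>v\<in>reg E. \<forall>e\<in>out_arcs E v. \<forall>i<length (snd (f (epath E e))).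
        \<forall>d\<in>out_arcs F (tail F (snd (f (epath E e)) ! i)).
          \<exists>e'\<in>out_arcs E v.
            prefix (take i (snd (f (epath E e))) @ [d]) (snd (f (epath E e'))))"

context mono_path_homomorphism
begin

lemma fst_edge: "e \<in> out_arcs E v \<Longrightarrow> e' \<in> out_arcs E v \<Longrightarrow> fst (f (epath E e)) = fst (f (epath E e'))"
  by (subst fst_inject) (auto simp: E.epath_FP, simp add: epath_def)

text \<open>An edge that is collapsed to a vertex is below every parallel edge, hence is a lone loop.\<close>

lemma collapsed_edge:
  assumes e: "e \<in> out_arcs E v" and Nil: "snd (f (epath E e)) = []"
  shows "v \<in> reg0 E" "f ` epath E ` out_arcs E v = {f (vpath v)}"
proof -
  have "e' = e" if "e' \<in> out_arcs E v" for e'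
    using edge_eq[of e e'] fst_edge[OF e that] e that Nil by (auto simp: path_prefix_def)
  then have out: "out_arcs E v = {e}" using e by blast
  have eFP: "epath E e \<in> FP E" "v \<in> verts E" "tail E e = v" using e by (auto simp: E.epath_FP)
  obtain w where w: "f (epath E e) = vpath w"
    using Nil by (cases "f (epath E e)") (simp add: vpath_def)
  have fv: "f (vpath v) = vpath w"
    using vpath_psrc[OF eFP(1)] w eFP(3) by (simp add: psrc_def epath_def vpath_def)
  \<comment> \<open>As the image is a single vertex, both ends of \<open>e\<close> have the same
    image; injectivity on vertices then makes \<open>e\<close> a loop.\<close>
  have "f (vpath (head E e)) = f (vpath v)"
    using vpath_ptgt[OF eFP(1)] fv w by (simp add: epath_def vpath_def)
  then have "head E e = v"
    using e eFP f_vpath_inject[of "head E e" v] by (auto simp: epath_def)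
  then show "v \<in> reg0 E" using out eFP(2) by (auto simp: reg0_def reg_def)
  show "f ` epath E ` out_arcs E v = {f (vpath v)}" using out fv w by simp
qed

text \<open>By monotonicity no image of an edge is a prefix of the image of another, which gives
  \<open>(a)\<close> and \<open>(ii)\<close>. The converse direction of \<open>(b)\<close> comes
  from combining \<open>(ii)\<close> with \<open>(iii)\<close> at the last edge of
  \<open>p\<close>.\<close>

lemma reg_at_iff:
  assumes v: "v \<in> reg E"
  shows "reg_at E F f v \<longleftrightarrow>
     (\<forall>e\<in>out_arcs E v. snd (f (epath E e)) \<noteq> [] \<and> (\<forall>i<length (snd (f (epath E e))).
        \<forall>d\<in>out_arcs F (tail F (snd (f (epath E e)) ! i)).
          \<exists>e'\<in>out_arcs E v.
            prefix (take i (snd (f (epath E e))) @ [d]) (snd (f (epath E e')))))"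
    (is "_ \<longleftrightarrow> ?R")
proof -
  define A where "A = f ` epath E ` out_arcs E v"
  have A_iff: "p \<in> A \<longleftrightarrow> (\<exists>e\<in>out_arcs E v. p = f (epath E e))" for p
    unfolding A_def by (simp only: image_image image_iff)
  let ?P1 = "\<lambda>p. \<forall>q\<in>FP F. ptgt F p = psrc q \<longrightarrow> pconc p q \<in> A \<longrightarrow> q = vpath (ptgt F p)"
  let ?P2 = "\<lambda>p. \<forall>i<length (snd p). \<forall>e\<in>out_arcs F (tail F (snd p ! i)).
           \<exists>r\<in>FP F. psrc r = head F e \<and> pconc (psrc p, take i (snd p) @ [e]) r \<in> A"
  have arcs: "e \<in> arcs E" if "e \<in> out_arcs E v" for e using that by simp
  have inj: "inj_on (\<lambda>e. f (epath E e)) (out_arcs E v)"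
    by (rule inj_onI) (metis arcs edge_eq path_prefix_refl)
  have A_FP: "p \<in> FP F" if "p \<in> A" for p
    using that by (auto simp: A_iff FP E.epath_FP)
  have P1: "?P1 p" if pA: "p \<in> A" for p
  proof (intro ballI impI)
    fix q
    assume q: "q \<in> FP F" "ptgt F p = psrc q" "pconc p q \<in> A"
    obtain e e' where e: "e \<in> out_arcs E v" "p = f (epath E e)"
      and e': "e' \<in> out_arcs E v" "pconc p q = f (epath E e')" using pA q(3) unfolding A_iff by blast
    have "path_prefix p (pconc p q)" by (simp add: path_prefix_def pconc_def)
    then have "pconc p q = p" using edge_eq[of e e'] e e' by simp
    then show "q = vpath (ptgt F p)"
      using q by (auto simp: pconc_def vpath_def psrc_def prod_eq_iff)
  qed
  have P2: "(\<exists>r\<in>FP F. psrc r = head F d \<and> pconc (psrc p, take i (snd p) @ [d]) r \<in> A) \<longleftrightarrow>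
      (\<exists>e'\<in>out_arcs E v. prefix (take i (snd p) @ [d]) (snd (f (epath E e'))))"
    (is "?X \<longleftrightarrow> ?Y") if p: "p = f (epath E e)" "e \<in> out_arcs E v" for p e i d
  proof
    assume ?X
    then obtain r e' where e': "e' \<in> out_arcs E v"
      "f (epath E e') = pconc (psrc p, take i (snd p) @ [d]) r" unfolding A_iff by metis
    then show ?Y by (intro bexI[of _ e']) (simp_all add: pconc_def)
  next
    assume ?Y
    then obtain e' zs where e': "e' \<in> out_arcs E v"
      and zs: "snd (f (epath E e')) = take i (snd p) @ [d] @ zs" by (auto simp: prefix_def)
    \<comment> \<open>Edges leaving \<open>v\<close> have images with a common source, so the edge
      list determines the image.\<close>
    have fe': "f (epath E e') = (psrc p, take i (snd p) @ [d] @ zs)"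
      using zs fst_edge[OF p(2) e'] p by (simp add: psrc_def prod_eq_iff)
    have "f (epath E e') \<in> FP F" using e' by (simp add: FP E.epath_FP)
    then have "(head F d, zs) \<in> FP F" unfolding fe'
      by (simp add: F.append_FP_iff F.Cons_FP_iff)
    moreover have "pconc (psrc p, take i (snd p) @ [d]) (head F d, zs) \<in> A"
      unfolding A_iff using fe' e' by (intro bexI[of _ e']) (simp_all add: pconc_def)
    ultimately show ?X by (intro bexI[of _ "(head F d, zs)"]) (simp_all add: psrc_def)
  qed
  have in_A: "p \<in> A" if p: "p \<in> FP F" "snd p \<noteq> []" "?P1 p" "?P2 p" for p
  proof -
    obtain u es d where pe: "p = (u, es @ [d])"
      using p(2) by (cases p; cases "snd p" rule: rev_cases) auto
    have d: "d \<in> arcs F" "ptgt F p = head F d"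
      using p(1) unfolding pe by (simp_all add: F.append_FP_iff F.Cons_FP_iff F.ptgt_append)
    \<comment> \<open>The edge substituted at the last position is that edge itself. This gives an
      extension of \<open>p\<close> in \<open>A\<close>, which \<open>(ii)\<close> forces to be
      \<open>p\<close>.\<close>
    obtain r where r: "r \<in> FP F" "psrc r = head F d" "pconc p r \<in> A"
      using p(4)[rule_format, of "length es" d] d by (auto simp: pe psrc_def)
    then have "r = vpath (ptgt F p)" using p(3)[rule_format, OF r(1) _ r(3)] r(2) d(2) by simp
    then show ?thesis using r(3) by (simp add: pconc_def vpath_def)
  qed
  have "reg_at E F f v \<longleftrightarrow> (\<forall>p\<in>FP F. p \<in> A \<longleftrightarrow> snd p \<noteq> [] \<and> ?P1 p \<and> ?P2 p)"
    using inj unfolding reg_at_def Let_def A_def by simp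
  also have "\<dots> \<longleftrightarrow> (\<forall>p\<in>A. snd p \<noteq> [] \<and> ?P2 p)"
  proof (rule iffI; rule ballI)
    fix p
    assume "\<forall>p\<in>FP F. p \<in> A \<longleftrightarrow> snd p \<noteq> [] \<and> ?P1 p \<and> ?P2 p" "p \<in> A"
    then show "snd p \<noteq> [] \<and> ?P2 p" using A_FP[of p] by (elim ballE[of _ _ p]) simp_all
  next
    fix p
    assume *: "\<forall>p\<in>A. snd p \<noteq> [] \<and> ?P2 p" and p: "p \<in> FP F"
    show "p \<in> A \<longleftrightarrow> snd p \<noteq> [] \<and> ?P1 p \<and> ?P2 p"
    proof
      assume "p \<in> A"
      then show "snd p \<noteq> [] \<and> ?P1 p \<and> ?P2 p" using P1[of p] *[rule_format, of p] by (intro conjI) simp_all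
    next
      assume "snd p \<noteq> [] \<and> ?P1 p \<and> ?P2 p"
      then show "p \<in> A" using in_A[OF p] by simp
    qed
  qed
  also have "\<dots> \<longleftrightarrow> (\<forall>e\<in>out_arcs E v. snd (f (epath E e)) \<noteq> [] \<and> ?P2 (f (epath E e)))"
    unfolding A_def by (simp only: ball_simps)
  also have "\<dots> \<longleftrightarrow> ?R"
  proof (rule ball_cong[OF refl])
    fix e
    assume e: "e \<in> out_arcs E v"
    note P2' = P2[OF refl e]
    show "(snd (f (epath E e)) \<noteq> [] \<and> ?P2 (f (epath E e))) \<longleftrightarrow>
      snd (f (epath E e)) \<noteq> [] \<and> (\<forall>i<length (snd (f (epath E e))).
        \<forall>d\<in>out_arcs F (tail F (snd (f (epath E e)) ! i)).
          \<exists>e'\<in>out_arcs E v.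
            prefix (take i (snd (f (epath E e))) @ [d]) (snd (f (epath E e'))))"
      unfolding P2' by (rule refl)
  qed
  finally show ?thesis .
qed

text \<open>If \<open>reg_at\<close> fails, all images of edges leaving \<open>v\<close> are empty
  and branching is vacuous. Conversely, \<open>collapsed_edge\<close> turns one empty image into the
  alternative allowed on \<open>reg0\<close>; without empty images, branching is
  \<open>reg_at\<close>.\<close>

lemma regular_iff_branching: "regular_path_hom E F f \<longleftrightarrow> branching E F f"
proof
  assume reg: "regular_path_hom E F f"
  show "branching E F f"
    unfolding branching_def
  proof
    fix v
    assume v: "v \<in> reg E"
    show "\<forall>e\<in>out_arcs E v. \<forall>i<length (snd (f (epath E e))).
        \<forall>d\<in>out_arcs F (tail F (snd (f (epath E e)) ! i)). \<exists>e'\<in>out_arcs E v.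
            prefix (take i (snd (f (epath E e))) @ [d]) (snd (f (epath E e')))"
    proof (cases "reg_at E F f v")
      case True
      then show ?thesis by (simp add: reg_at_iff[OF v])
    next
      case False
      then have "f ` epath E ` out_arcs E v = {f (vpath v)}"
        using reg v unfolding regular_path_hom_def by blast
      moreover have "snd (f (vpath v)) = []" using v snd_Nil by (simp add: reg_def vpath_def)
      ultimately have "snd (f (epath E e)) = []" if "e \<in> out_arcs E v" for e
        using that by (metis imageI singletonD)
      then show ?thesis by simp
    qed
  qed
next
  assume br: "branching E F f"
  have "reg_at E F f v \<or> v \<in> reg0 E \<and> f ` epath E ` out_arcs E v = {f (vpath v)}"
    if v: "v \<in> reg E" for v
  proof (cases "\<exists>e\<in>out_arcs E v. snd (f (epath E e)) = []")
    case True
    then show ?thesis using collapsed_edge by blast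
  next
    case False
    then show ?thesis using br v by (simp add: reg_at_iff[OF v] branching_def)
  qed
  then show "regular_path_hom E F f"
    using hom unfolding regular_path_hom_def reg0_def by blast
qed

end

lemma RMIPG_hom_iff:
  assumes "wf_digraph E" "wf_digraph F"
  shows "f \<in> RMIPG_hom E F \<longleftrightarrow> mono_path_homomorphism E F f \<and> branching E F f"
proof -
  have "mono_path_homomorphism E F f \<longleftrightarrow>
      path_hom E F f \<and> monotonic E F f \<and> inj_on f (vpath ` verts E)"
    using assms
    by (simp add: mono_path_homomorphism_def path_homomorphism_def
        mono_path_homomorphism_axioms_def path_homomorphism_axioms_def)
  then show ?thesis
    using mono_path_homomorphism.regular_iff_branching[of E F f]
    unfolding RMIPG_hom_def regular_path_hom_def by blast
qed


section \<open>The functor\<close>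

lemma phi_None [simp]: "phi E f None = None"
  by (simp add: phi_def gis_def)

lemma phi_Some: "Some (\<alpha>, \<beta>) \<in> gis E \<Longrightarrow> phi E f (Some (\<alpha>, \<beta>)) = Some (f \<alpha>, f \<beta>)"
  by (simp add: phi_def)

lemma phi_idem: "p \<in> FP E \<Longrightarrow> phi E f (idem p) = idem (f p)"
  by (simp add: idem_def phi_Some gis_def)

lemma (in path_homomorphism) phi_PiE: "phi E f \<in> gis E \<rightarrow>\<^sub>E gis F"
proof (rule PiE_I)
  fix s
  assume "s \<in> gis E"
  then show "phi E f s \<in> gis F"
    by (cases s) (auto simp: phi_Some E.Some_gis_iff F.Some_gis_iff FP ptgt_eq simp del: split_paired_All)
qed (simp add: phi_def)

text \<open>Prefixes are preserved, so nonzero products are respected; comparability is reflected,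
  so zero products stay zero.\<close>

lemma (in mono_path_homomorphism) phi_ext_path_hom: "ext_path_hom E F (phi E f)"
proof -
  have "phi E f (s \<odot> t) = phi E f s \<odot> phi E f t" if st: "s \<in> gis E" "t \<in> gis E" for s t
  proof (cases "s = None \<or> t = None")
    case True
    then show ?thesis by auto
  next
    case False
    then obtain \<alpha> \<beta> \<gamma> \<delta> where s: "s = Some (\<alpha>, \<beta>)" and t: "t = Some (\<gamma>, \<delta>)" by auto
    have FP': "\<alpha> \<in> FP E" "\<beta> \<in> FP E" "ptgt E \<alpha> = ptgt E \<beta>"
      "\<gamma> \<in> FP E" "\<delta> \<in> FP E" "ptgt E \<gamma> = ptgt E \<delta>" using st by (auto simp: s t E.Some_gis_iff)
    have comp: "f (fst \<alpha>, snd \<alpha> @ drop (length (snd \<beta>)) (snd \<gamma>)) =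
        (fst (f \<alpha>), snd (f \<alpha>) @ drop (length (snd (f \<beta>))) (snd (f \<gamma>)))"
      if "path_prefix \<beta> \<gamma>" "\<alpha> \<in> FP E" "\<gamma> \<in> FP E" "ptgt E \<alpha> = ptgt E \<beta>" for \<alpha> \<beta> \<gamma>
    proof -
      have "(fst \<alpha>, snd \<alpha> @ drop (length (snd \<beta>)) (snd \<gamma>)) \<in> FP E"
        using E.path_prefix_FP(2)[OF that(1,3)] that by (simp add: E.append_FP_iff)
      then show ?thesis
        using append drop[OF that(1,3)] that(4) by (simp add: pconc_def)
    qed
    have p: "phi E f s = Some (f \<alpha>, f \<beta>)" "phi E f t = Some (f \<gamma>, f \<delta>)"
      using st by (simp_all add: s t phi_Some)
    note st_gis = E.pmult_gis[OF st]
    consider (le) "path_prefix \<beta> \<gamma>"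
      | (ge) "path_prefix \<gamma> \<beta>" "\<not> path_prefix \<beta> \<gamma>"
      | (none) "\<not> comparable \<beta> \<gamma>" by (auto simp: comparable_def)
    then show ?thesis
    proof cases
      case le
      have "path_prefix (f \<beta>) (f \<gamma>)" using path_prefix le FP' by blast
      then show ?thesis
        using st_gis le comp[of \<beta> \<gamma> \<alpha>] FP' unfolding p by (simp add: s t pmult_def phi_Some)
    next
      case ge
      have fge: "path_prefix (f \<gamma>) (f \<beta>)" using path_prefix ge FP' by blast
      have "s \<odot> t = Some (\<alpha>, (fst \<delta>, snd \<delta> @ drop (length (snd \<gamma>)) (snd \<beta>)))"
        using ge by (simp add: s t pmult_def)
      then have "phi E f (s \<odot> t) =
          Some (f \<alpha>, (fst (f \<delta>), snd (f \<delta>) @ drop (length (snd (f \<gamma>))) (snd (f \<beta>))))"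
        using st_gis ge comp[of \<gamma> \<beta> \<delta>] FP' by (simp add: phi_Some)
      \<comment> \<open>A proper prefix may become equal to the whole path when collapsed loops are
        removed. The first branch of \<open>pmult\<close> then applies, and for equal paths it
        agrees with the second.\<close>
      moreover have "path_prefix (f \<beta>) (f \<gamma>) \<Longrightarrow> f \<beta> = f \<gamma>"
        using fge by (metis path_prefix_antisym)
      ultimately show ?thesis
        using fge unfolding p by (auto simp: pmult_def)
    next
      case none
      then have "\<not> comparable (f \<beta>) (f \<gamma>)" using comparable_iff FP' by blast
      then show ?thesis using none unfolding p by (simp add: s t pmult_def comparable_def)
    qed
  qed
  then show ?thesis
    using phi_PiE E.wf_digraph_axioms F.wf_digraph_axioms by (simp add: ext_path_hom_iff)
qed

text \<open>
  Following a path \<open>p\<close> edge by edge, branching allows the image of an edge leaving \<open>u\<close> to be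
  corrected at the first place where it departs from \<open>p\<close>.
\<close>

lemma (in mono_path_homomorphism) branching_comparable:
  assumes br: "branching E F f" and u: "u \<in> reg E"
    and p: "p \<in> FP F" "fst p = fst (f (vpath u))"
  shows "\<exists>e\<in>out_arcs E u. comparable (f (epath E e)) p"
proof -
  have "\<exists>e\<in>out_arcs E u. comparable (f (epath E e)) (fst p, take k (snd p))" for k
  proof (induction k)
    case 0
    obtain e where e: "e \<in> out_arcs E u" using u unfolding reg_def by blast
    have "fst (f (epath E e)) = fst (f (vpath u))"
      using e u by (subst fst_inject) (simp_all add: reg_def E.epath_FP E.vpath_FP, simp add: epath_def vpath_def)
    then show ?case using e p by (intro bexI[of _ e]) (simp_all add: comparable_def path_prefix_def)
  next
    case (Suc k)
    then obtain e where e: "e \<in> out_arcs E u"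
      and c: "comparable (f (epath E e)) (fst p, take k (snd p))" by blast
    show ?case
    proof (cases "k < length (snd p) \<and> k < length (snd (f (epath E e)))")
      \<comment> \<open>Either \<open>p\<close> has no further edge, or the image of
        \<open>e\<close> already ends within the first \<open>k\<close> edges; in both cases
        \<open>e\<close> still serves.\<close>
      case False
      then have "comparable (f (epath E e)) (fst p, take (Suc k) (snd p))"
      proof (cases "k < length (snd p)")
        case True
        then have "path_prefix (f (epath E e)) (fst p, take k (snd p))"
          using c
        proof (unfold comparable_def, elim disjE)
          assume pre: "path_prefix (fst p, take k (snd p)) (f (epath E e))"
          then obtain zs where "snd (f (epath E e)) = take k (snd p) @ zs"
            by (auto simp: path_prefix_def prefix_def)
          then show ?thesis using True False pre by (simp add: path_prefix_def)
        qed
        moreover have "path_prefix (fst p, take k (snd p)) (fst p, take (Suc k) (snd p))"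
          using True by (simp add: path_prefix_def take_Suc_conv_app_nth)
        ultimately show ?thesis by (metis comparable_def path_prefix_trans)
      qed (use c in simp)
      then show ?thesis using e by blast
    next
      case True
      define xs where "xs = snd (f (epath E e))"
      define d where "d = snd p ! k"
      have le: "fst (f (epath E e)) = fst p" "take k xs = take k (snd p)"
        using c True prefix_length_le[of "snd (f (epath E e))" "take k (snd p)"]
        by (auto simp: comparable_def path_prefix_def prefix_def xs_def)
      have pk: "snd p = take k (snd p) @ d # drop (Suc k) (snd p)"
        using True unfolding d_def by (simp add: id_take_nth_drop)
      have xsk: "xs = take k (snd p) @ xs ! k # drop (Suc k) xs"
        using True le(2) unfolding xs_def by (metis id_take_nth_drop)
      have "(fst p, take k (snd p) @ d # drop (Suc k) (snd p)) \<in> FP F"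
        using p(1) pk by (metis prod.collapse)
      then have d: "d \<in> arcs F" "tail F d = ptgt F (fst p, take k (snd p))"
        by (auto simp: F.append_FP_iff F.Cons_FP_iff)
      have "(fst p, xs) \<in> FP F"
        using FP[of "epath E e"] e by (simp add: xs_def E.epath_FP flip: le(1))
      then have "tail F (xs ! k) = ptgt F (fst p, take k (snd p))"
        by (subst (asm) xsk) (auto simp: F.append_FP_iff F.Cons_FP_iff)
      \<comment> \<open>The next edges of \<open>p\<close> and of the image of \<open>e\<close> both
        leave the target of the common prefix, so branching may replace the latter by
        \<open>d\<close>.\<close>
      then have "d \<in> out_arcs F (tail F (snd (f (epath E e)) ! k))" using d by (simp add: xs_def)
      then obtain e' where e': "e' \<in> out_arcs E u"
        and pre: "prefix (take k xs @ [d]) (snd (f (epath E e')))"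
        using br u e True unfolding branching_def xs_def by blast
      have "take (Suc k) (snd p) = take k xs @ [d]"
        using True le(2) by (simp add: take_Suc_conv_app_nth d_def)
      then have "path_prefix (fst p, take (Suc k) (snd p)) (f (epath E e'))"
        using pre fst_edge[OF e e'] le(1) by (simp add: path_prefix_def)
      then show ?thesis using e' by (auto simp: comparable_def)
    qed
  qed
  from this[of "length (snd p)"] show ?thesis by simp
qed

lemma phi_REG_hom:
  assumes "wf_digraph E" "wf_digraph F" "f \<in> RMIPG_hom E F"
  shows "phi E f \<in> REG_hom E F"
proof -
  interpret mono_path_homomorphism E F f
    using assms by (simp add: RMIPG_hom_iff)
  have br: "branching E F f" using assms by (simp add: RMIPG_hom_iff)
  have "\<exists>e\<in>out_arcs E u. idem p \<odot> phi E f (idem (epath E e)) \<noteq> None"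
    if u: "u \<in> reg E" and p: "p \<in> FP F" "idem p \<odot> phi E f (idem (vpath u)) = idem p" for u p
  proof -
    have "vpath u \<in> FP E" using u by (simp add: reg_def E.vpath_FP)
    then have "fst p = fst (f (vpath u))" using p(2) by (simp add: phi_idem path_prefix_def)
    then obtain e where e: "e \<in> out_arcs E u" "comparable (f (epath E e)) p"
      using branching_comparable[OF br u p(1)] by blast
    then show ?thesis
      by (intro bexI[of _ e]) (simp_all add: phi_idem E.epath_FP comparable_commute)
  qed
  then show ?thesis using phi_ext_path_hom assms by (simp add: REG_hom_iff)
qed


section \<open>Composition of regular path homomorphisms\<close>

text \<open>For branching, position \<open>i\<close> of \<open>g(f(e))\<close> lies at some offset
  \<open>j\<close> in the image of an edge \<open>y\<close> of \<open>f(e)\<close>. Branching of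
  \<open>g\<close> replaces \<open>y\<close> by some \<open>y'\<close>, and branching of
  \<open>f\<close> realises \<open>y'\<close> after the edges preceding \<open>y\<close>.\<close>

lemma RMIPG_hom_compose:
  assumes wf: "wf_digraph E" "wf_digraph F" "wf_digraph G"
    and "f \<in> RMIPG_hom E F" "g \<in> RMIPG_hom F G"
  shows "compose (FP E) g f \<in> RMIPG_hom E G"
proof -
  interpret f: mono_path_homomorphism E F f using assms by (simp add: RMIPG_hom_iff)
  interpret g: mono_path_homomorphism F G g using assms by (simp add: RMIPG_hom_iff)
  have brf: "branching E F f" and brg: "branching F G g"
    using assms by (simp_all add: RMIPG_hom_iff)
  let ?h = "compose (FP E) g f"
  have h: "?h p = g (f p)" if "p \<in> FP E" for p using that by (simp add: compose_def)
  have f_vpath: "\<exists>w\<in>verts F. f (vpath v) = vpath w" if "v \<in> verts E" for v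
    using f.hom that unfolding path_hom_def by blast
  have g_vpath: "\<exists>w\<in>verts G. g (vpath v) = vpath w" if "v \<in> verts F" for v
    using g.hom that unfolding path_hom_def by blast
  have "path_hom E G ?h"
    unfolding path_hom_def
  proof (intro conjI ballI impI)
    show "?h \<in> FP E \<rightarrow>\<^sub>E FP G" using f.FP g.FP by (auto simp: compose_def)
    show "?h ` vpath ` verts E \<subseteq> vpath ` verts G"
    proof -
      have "?h (vpath v) \<in> vpath ` verts G" if v: "v \<in> verts E" for v
      proof -
        obtain w where w: "w \<in> verts F" "f (vpath v) = vpath w" using f_vpath[OF v] by blast
        obtain x where "x \<in> verts G" "g (vpath w) = vpath x" using g_vpath[OF w(1)] by blast
        with w show ?thesis using v by (simp add: h f.E.vpath_FP)
      qed
      then show ?thesis by (simp add: image_subset_iff)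
    qed
  next
    fix p
    assume p: "p \<in> FP E"
    show "?h (vpath (psrc p)) = vpath (psrc (?h p))"
      using p f.vpath_psrc[OF p] g.vpath_psrc[OF f.FP[OF p]]
      by (simp add: h f.E.vpath_FP f.E.psrc_verts)
    show "?h (vpath (ptgt E p)) = vpath (ptgt G (?h p))"
      using p f.vpath_ptgt[OF p] g.vpath_ptgt[OF f.FP[OF p]]
      by (simp add: h f.E.vpath_FP f.E.ptgt_verts)
  next
    fix p q
    assume pq: "p \<in> FP E" "q \<in> FP E" "ptgt E p = psrc q"
    have "ptgt F (f p) = psrc (f q)"
      using trans[OF f.vpath_ptgt[OF pq(1), unfolded pq(3)] f.vpath_psrc[OF pq(2), symmetric]]
      by (simp add: vpath_def)
    then have "g (pconc (f p) (f q)) = pconc (g (f p)) (g (f q))"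
      using g.hom f.FP pq by (simp add: path_hom_def vpath_def)
    moreover have "f (pconc p q) = pconc (f p) (f q)"
      using f.hom pq by (simp add: path_hom_def)
    ultimately show "?h (pconc p q) = pconc (?h p) (?h q)"
      using pq by (simp add: h f.E.pconc_FP)
  qed
  moreover have "monotonic E G ?h"
    unfolding monotonic_def
  proof (intro ballI impI)
    fix e e'
    assume e: "e \<in> arcs E" "e' \<in> arcs E" and le: "path_le G (?h (epath E e)) (?h (epath E e'))"
    \<comment> \<open>Images under \<open>f\<close> are paths rather than edges, so monotonicity of
      \<open>g\<close> enters through reflection of comparability.\<close>
    then have "comparable (g (f (epath E e))) (g (f (epath E e')))"
      by (simp add: h f.E.epath_FP f.FP g.FP g.F.path_le_iff comparable_def)
    then show "e = e'"
      using e f.edge_eq_comparable[of e e'] by (simp add: g.comparable_iff f.E.epath_FP f.FP)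
  qed
  moreover have "inj_on ?h (vpath ` verts E)"
  proof (rule inj_onI)
    fix p q
    assume pq: "p \<in> vpath ` verts E" "q \<in> vpath ` verts E" "?h p = ?h q"
    then obtain u v where u: "u \<in> verts E" "p = vpath u" and v: "v \<in> verts E" "q = vpath v"
      by blast
    obtain x where x: "x \<in> verts F" "f p = vpath x" using f_vpath[OF u(1)] u(2) by auto
    obtain y where y: "y \<in> verts F" "f q = vpath y" using f_vpath[OF v(1)] v(2) by auto
    have "g (vpath x) = g (vpath y)"
      using pq(3) u v x(2) y(2) by (simp add: h f.E.vpath_FP)
    then have "x = y" using g.f_vpath_inject[OF x(1) y(1)] by simp
    then have "f (vpath u) = f (vpath v)" using u v x y by simp
    then show "p = q" using u v f.f_vpath_inject[OF u(1) v(1)] by simp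
  qed
  ultimately interpret h: mono_path_homomorphism E G ?h
    using wf by (simp add: mono_path_homomorphism_def path_homomorphism_def
        mono_path_homomorphism_axioms_def path_homomorphism_axioms_def)
  have "branching E G ?h"
    unfolding branching_def
  proof (intro ballI allI impI)
    fix v e i d
    assume v: "v \<in> reg E" and e: "e \<in> out_arcs E v"
      and i: "i < length (snd (?h (epath E e)))"
      and d: "d \<in> out_arcs G (tail G (snd (?h (epath E e)) ! i))"
    define p where "p = f (epath E e)"
    have he: "?h (epath E e') = g (f (epath E e'))" if "e' \<in> out_arcs E v" for e'
      using that by (simp add: h f.E.epath_FP)
    have pFP: "(fst p, snd p) \<in> FP F" using e f.FP by (simp add: p_def f.E.epath_FP)
    have locate: "\<exists>xs y ys j. zs = xs @ y # ys \<and> j < length (snd (g (epath F y))) \<and>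
        i = length (snd (g (u, xs))) + j"
      if "(u, zs) \<in> FP F" "i < length (snd (g (u, zs)))" for u zs i
      using that
    proof (induction zs arbitrary: u i)
      case Nil
      then show ?case by (simp add: g.snd_Nil)
    next
      case (Cons z zs)
      have z: "z \<in> arcs F" "u = tail F z" "(head F z, zs) \<in> FP F"
        using Cons.prems(1) by (auto simp: f.F.Cons_FP_iff)
      have gz: "snd (g (u, z # zs)) = snd (g (epath F z)) @ snd (g (head F z, zs))"
        using g.edge_append[OF Cons.prems(1)] by (simp add: pconc_def)
      show ?case
      proof (cases "i < length (snd (g (epath F z)))")
        case True
        have "snd (g (u, [])) = []" using z by (simp add: g.snd_Nil)
        then show ?thesis using True
          by (intro exI[of _ "[]"] exI[of _ z] exI[of _ zs] exI[of _ i]) simp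
      next
        case False
        then have "i - length (snd (g (epath F z))) < length (snd (g (head F z, zs)))"
          using Cons.prems(2) gz by simp
        then obtain xs y ys j where "zs = xs @ y # ys" "j < length (snd (g (epath F y)))"
          "i - length (snd (g (epath F z))) = length (snd (g (head F z, xs))) + j"
          using Cons.IH[OF z(3), of "i - length (snd (g (epath F z)))"] by blast
        moreover from this have "(u, z # xs) \<in> FP F"
          using z by (simp add: f.F.Cons_FP_iff f.F.append_FP_iff)
        then have "snd (g (u, z # xs)) = snd (g (epath F z)) @ snd (g (head F z, xs))"
          using g.edge_append by (simp add: pconc_def)
        ultimately show ?thesis using False
          by (intro exI[of _ "z # xs"] exI[of _ y] exI[of _ ys] exI[of _ j]) simp
      qed
    qed
    have "i < length (snd (g (fst p, snd p)))" using i he[OF e] by (simp add: p_def)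
    then obtain xs y ys j where split: "snd p = xs @ y # ys"
      and j: "j < length (snd (g (epath F y)))" "i = length (snd (g (fst p, xs))) + j"
      using locate[OF pFP] by blast
    have xs: "(fst p, xs) \<in> FP F" and y: "y \<in> arcs F" "tail F y = ptgt F (fst p, xs)"
      and ys: "(head F y, ys) \<in> FP F"
      using pFP unfolding split by (auto simp: f.F.append_FP_iff f.F.Cons_FP_iff)
    have g_split: "snd (g (fst p, xs @ x # zs)) =
        snd (g (fst p, xs)) @ snd (g (epath F x)) @ snd (g (head F x, zs))"
      if "(fst p, xs @ x # zs) \<in> FP F" for x zs
      using g.append[OF that] g.edge_append[of "ptgt F (fst p, xs)" x zs] that
      by (simp add: f.F.append_FP_iff pconc_def)
    have gp: "snd (?h (epath E e)) =
        snd (g (fst p, xs)) @ snd (g (epath F y)) @ snd (g (head F y, ys))"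
    proof -
      have "?h (epath E e) = g (fst p, xs @ y # ys)"
        unfolding split[symmetric] using he[OF e] by (simp add: p_def)
      then show ?thesis using g_split[of y ys] pFP unfolding split by simp
    qed
    have branch: "\<exists>e'\<in>out_arcs E v. prefix (xs @ [x]) (snd (f (epath E e')))"
      if "x \<in> out_arcs F (tail F y)" for x
    proof -
      have "length xs < length (snd (f (epath E e)))" "snd (f (epath E e)) ! length xs = y"
        "take (length xs) (snd (f (epath E e))) = xs"
        using split by (simp_all add: p_def)
      then show ?thesis
        using brf[unfolded branching_def, rule_format, OF v e, of "length xs" x] that by simp
    qed
    have "tail F y \<in> reg F"
    proof -
      \<comment> \<open>By branching of \<open>f\<close>, each edge leaving \<open>tail F y\<close>
        stands at position \<open>length xs\<close> in the image of one of the finitely many edges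
        leaving \<open>v\<close>.\<close>
      have "out_arcs F (tail F y) \<subseteq> (\<lambda>e'. snd (f (epath E e')) ! length xs) ` out_arcs E v"
      proof
        fix x
        assume "x \<in> out_arcs F (tail F y)"
        from branch[OF this]
        obtain e' zs where "e' \<in> out_arcs E v" "snd (f (epath E e')) = xs @ [x] @ zs"
          unfolding prefix_def append_assoc by blast
        then show "x \<in> (\<lambda>e'. snd (f (epath E e')) ! length xs) ` out_arcs E v"
          by (intro image_eqI[of _ _ e']) simp_all
      qed
      moreover have "finite (out_arcs E v)" using v by (simp add: reg_def)
      ultimately have "finite (out_arcs F (tail F y))" by (metis finite_surj)
      then show ?thesis using y(1) by (auto simp: reg_def)
    qed
    moreover have "snd (?h (epath E e)) ! i = snd (g (epath F y)) ! j"
      using j by (simp add: gp nth_append)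
    ultimately obtain y' where y': "y' \<in> out_arcs F (tail F y)"
      and pre: "prefix (take j (snd (g (epath F y))) @ [d]) (snd (g (epath F y')))"
      using brg[unfolded branching_def, rule_format, of "tail F y" y j d] j(1) d y(1) by auto
    obtain e' zs where e': "e' \<in> out_arcs E v" and zs: "snd (f (epath E e')) = xs @ y' # zs"
      using branch[OF y'] by (auto simp: prefix_def)
    have fe': "f (epath E e') = (fst p, xs @ y' # zs)"
      using zs f.fst_edge[OF e e'] by (simp add: p_def prod_eq_iff)
    have "(fst p, xs @ y' # zs) \<in> FP F"
      using f.FP[of "epath E e'"] e' by (simp add: fe' f.E.epath_FP)
    then have "snd (?h (epath E e')) =
        snd (g (fst p, xs)) @ snd (g (epath F y')) @ snd (g (head F y', zs))"
      using g_split he[OF e'] fe' by simp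
    moreover have "take i (snd (?h (epath E e))) = snd (g (fst p, xs)) @ take j (snd (g (epath F y)))"
      using j by (simp add: gp)
    ultimately have "prefix (take i (snd (?h (epath E e))) @ [d]) (snd (?h (epath E e')))"
      using pre by (auto simp: prefix_def)
    then show "\<exists>e'\<in>out_arcs E v.
        prefix (take i (snd (?h (epath E e))) @ [d]) (snd (?h (epath E e')))"
      using e' by blast
  qed
  then show ?thesis
    using wf h.mono_path_homomorphism_axioms by (simp add: RMIPG_hom_iff)
qed


text \<open>
  If a nonzero idempotent \<open>t \<le> \<psi>(\<phi>(u,u)) = \<psi>(\<alpha>,\<alpha>)\<close> annihilated every \<open>\<psi>(\<phi>(e,e)) = \<psi>(q,q)\<close>, take a
  longest path \<open>p\<close> extending \<open>\<alpha>\<close> with \<open>t\<psi>(p,p) \<noteq> 0\<close>. Regularity of \<open>\<phi>\<close> makes \<open>p\<close> and its one-edge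
  extensions prefixes of the finitely many \<open>q\<close>, so the target \<open>w\<close> of \<open>p\<close> is regular. Regularity of \<open>\<psi>\<close> at \<open>w\<close>,
  applied to the conjugate of \<open>t\<close> by \<open>\<psi>(p,w)\<close>, then yields a longer path.
\<close>

lemma REG_hom_compose:
  fixes F :: "('w, 'f) pre_digraph"
  assumes wf: "wf_digraph E" "wf_digraph F" "wf_digraph G"
    and \<phi>: "\<phi> \<in> REG_hom E F" and \<psi>: "\<psi> \<in> REG_hom F G"
  shows "compose (gis E) \<psi> \<phi> \<in> REG_hom E G"
proof -
  interpret E: wf_digraph E by fact
  interpret F: wf_digraph F by fact
  interpret G: wf_digraph G by fact
  have \<phi>_gis: "\<phi> s \<in> gis F" if "s \<in> gis E" for s
    using \<phi> wf that by (auto simp: REG_hom_iff ext_path_hom_iff)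
  have \<psi>_gis: "\<psi> s \<in> gis G" if "s \<in> gis F" for s
    using \<psi> wf that by (auto simp: REG_hom_iff ext_path_hom_iff)
  have \<phi>_mult: "\<phi> (s \<odot> t) = \<phi> s \<odot> \<phi> t" if "s \<in> gis E" "t \<in> gis E" for s t
    using \<phi> wf that by (simp add: REG_hom_iff ext_path_hom_iff)
  have \<psi>_mult: "\<psi> (s \<odot> t) = \<psi> s \<odot> \<psi> t" if "s \<in> gis F" "t \<in> gis F" for s t
    using \<psi> wf that by (simp add: REG_hom_iff ext_path_hom_iff)
  have None: "\<phi> None = None" "\<psi> None = None"
    using \<phi> \<psi> wf by (simp_all add: REG_hom_iff ext_path_hom_iff)
  have \<phi>_reg: "\<exists>e\<in>out_arcs E u. idem p \<odot> \<phi> (idem (epath E e)) \<noteq> None"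
    if "u \<in> reg E" "p \<in> FP F" "idem p \<odot> \<phi> (idem (vpath u)) = idem p" for u p
    using \<phi> wf that by (simp add: REG_hom_iff)
  have \<psi>_reg: "\<exists>e\<in>out_arcs F u. idem p \<odot> \<psi> (idem (epath F e)) \<noteq> None"
    if "u \<in> reg F" "p \<in> FP G" "idem p \<odot> \<psi> (idem (vpath u)) = idem p" for u p
    using \<psi> wf that by (simp add: REG_hom_iff)
  let ?h = "compose (gis E) \<psi> \<phi>"
  have h: "?h s = \<psi> (\<phi> s)" if "s \<in> gis E" for s using that by (simp add: compose_def)
  have "ext_path_hom E G ?h"
    unfolding ext_path_hom_iff[OF wf(1,3)]
  proof (intro conjI ballI)
    show "?h \<in> gis E \<rightarrow>\<^sub>E gis G" using \<phi>_gis \<psi>_gis by (auto simp: compose_def)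
  qed (simp_all add: h E.pmult_gis \<phi>_mult \<psi>_mult \<phi>_gis None)
  moreover have "\<exists>e\<in>out_arcs E u. t \<odot> ?h (idem (epath E e)) \<noteq> None"
    if u: "u \<in> reg E" and r: "r \<in> FP G" "t = idem r" and le: "t \<odot> ?h (idem (vpath u)) = t"
    for u r t
  proof (rule ccontr)
    assume neg: "\<not> ?thesis"
    have u_gis: "idem (vpath u) \<in> gis E" using u by (simp add: reg_def E.vpath_FP)
    have e_gis: "idem (epath E e) \<in> gis E" if "e \<in> out_arcs E u" for e
      using that by (simp add: E.epath_FP)
    have t: "t \<odot> t = t" "t \<noteq> None" "t \<in> gis G" using r by simp_all
    have "\<phi> (idem (vpath u)) \<odot> \<phi> (idem (vpath u)) = \<phi> (idem (vpath u))"
      using \<phi>_mult[OF u_gis u_gis] by simp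
    moreover have "\<phi> (idem (vpath u)) \<noteq> None"
    proof
      assume "\<phi> (idem (vpath u)) = None"
      then have "?h (idem (vpath u)) = None" by (simp add: h[OF u_gis] None)
      then show False using le t(2) by simp
    qed
    ultimately obtain \<alpha> where \<alpha>: "\<phi> (idem (vpath u)) = idem \<alpha>"
      using idempotent_cases[of "\<phi> (idem (vpath u))"] by auto
    have \<alpha>_FP: "\<alpha> \<in> FP F" using \<phi>_gis[OF u_gis] \<alpha> by simp
    define P where "P p \<longleftrightarrow> p \<in> FP F \<and> path_prefix \<alpha> p \<and> t \<odot> \<psi> (idem p) \<noteq> None" for p
    define Q where "Q = {q. \<exists>e\<in>out_arcs E u. \<phi> (idem (epath E e)) = idem q}"
    have "Q \<subseteq> (\<lambda>e. fst (the (\<phi> (idem (epath E e))))) ` out_arcs E u"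
      by (force simp: Q_def idem_def)
    then have finite_Q: "finite Q"
      using u by (metis (no_types, lifting) finite_surj reg_def mem_Collect_eq)
    have Q_not_prefix: "\<not> path_prefix q p" if qQ: "q \<in> Q" and Pp: "P p" for p q
    proof
      assume qp: "path_prefix q p"
      obtain e where e: "e \<in> out_arcs E u" "\<phi> (idem (epath E e)) = idem q"
        using qQ unfolding Q_def by blast
      then have q: "q \<in> FP F" using \<phi>_gis[OF e_gis] by fastforce
      have p: "p \<in> FP F" using Pp by (simp add: P_def)
      \<comment> \<open>As \<open>q\<close> is a prefix of \<open>p\<close>, the element
        \<open>\<psi>(p,p)\<close> lies below \<open>\<psi>(q,q)\<close>, which \<open>t\<close>
        annihilates.\<close>
      have "idem q \<odot> idem p = idem p" using qp by (simp add: idem_pmult)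
      then have "t \<odot> \<psi> (idem p) = (t \<odot> \<psi> (idem q)) \<odot> \<psi> (idem p)"
        using \<psi>_mult[of "idem q" "idem p"] p q by (simp add: pmult_assoc)
      moreover have "t \<odot> ?h (idem (epath E e)) = None" using neg e(1) by blast
      then have "t \<odot> \<psi> (idem q) = None" by (simp only: h[OF e_gis[OF e(1)]] e(2))
      ultimately show False using Pp by (simp add: P_def)
    qed
    have Q_comparable: "\<exists>q\<in>Q. comparable p q" if p: "p \<in> FP F" "path_prefix \<alpha> p" for p
    proof -
      obtain e where e: "e \<in> out_arcs E u" "idem p \<odot> \<phi> (idem (epath E e)) \<noteq> None"
        using \<phi>_reg[OF u p(1)] p(2) \<alpha> by auto
      have "\<phi> (idem (epath E e)) \<odot> \<phi> (idem (epath E e)) = \<phi> (idem (epath E e))"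
        using \<phi>_mult[OF e_gis[OF e(1)] e_gis[OF e(1)]] by simp
      moreover have "\<phi> (idem (epath E e)) \<noteq> None" using e(2) by (metis pmult_None(2))
      ultimately obtain q where q: "\<phi> (idem (epath E e)) = idem q"
        using idempotent_cases[of "\<phi> (idem (epath E e))"] by auto
      then have "comparable p q" using e(2) by simp
      moreover have "q \<in> Q" unfolding Q_def mem_Collect_eq using q by (rule bexI) (rule e(1))
      ultimately show ?thesis by blast
    qed
    have P_prefix: "\<exists>q\<in>Q. path_prefix p q" if Pp: "P p" for p
    proof -
      have "p \<in> FP F" "path_prefix \<alpha> p" using Pp by (simp_all add: P_def)
      from Q_comparable[OF this] obtain q where "q \<in> Q" "comparable p q" by blast
      then show ?thesis using Q_not_prefix[OF _ Pp] by (auto simp: comparable_def)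
    qed
    have "P \<alpha>"
      using le t(2) \<alpha> \<alpha>_FP by (simp add: P_def h[OF u_gis])
    \<comment> \<open>Paths satisfying \<open>P\<close> are prefixes of members of the finite set
      \<open>Q\<close>, whose total length bounds theirs; a greatest element requires a strict
      bound, whence \<open>Suc\<close>.\<close>
    moreover have "length (snd p) < Suc (\<Sum>q\<in>Q. length (snd q))" if Pp: "P p" for p
    proof -
      obtain q where q: "q \<in> Q" "path_prefix p q" using P_prefix[OF Pp] by blast
      have "length (snd q) \<le> (\<Sum>q\<in>Q. length (snd q))"
        using finite_Q q(1) by (intro member_le_sum) auto
      then show ?thesis using path_prefix_length[OF q(2)] by linarith
    qed
    ultimately obtain p where Pp: "P p" and max: "\<And>p'. P p' \<Longrightarrow> length (snd p') \<le> length (snd p)"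
      using ex_has_greatest_nat[of P \<alpha> "\<lambda>p. length (snd p)"] by metis
    define w where "w = ptgt F p"
    have p: "p \<in> FP F" "path_prefix \<alpha> p" "t \<odot> \<psi> (idem p) \<noteq> None"
      using Pp by (simp_all add: P_def)
    have w: "w \<in> verts F" using p(1) by (simp add: w_def F.ptgt_verts)
    have snoc_FP: "(fst p, snd p @ [d]) \<in> FP F \<and> path_prefix \<alpha> (fst p, snd p @ [d])"
      if "d \<in> out_arcs F w" for d
      using that p by (auto simp: F.append_FP_iff F.Cons_FP_iff w_def path_prefix_def)
    have "w \<in> reg F"
    proof -
      obtain q where q: "q \<in> Q" "path_prefix p q" using P_prefix[OF Pp] by blast
      \<comment> \<open>No member of \<open>Q\<close> is a prefix of \<open>p\<close>, so
        \<open>q\<close> extends \<open>p\<close> properly and supplies an edge leaving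
        \<open>w\<close>.\<close>
      then have "q \<noteq> p" using Q_not_prefix[OF q(1) Pp] path_prefix_refl[of p] by metis
      then obtain d ds where ds: "q = (fst p, snd p @ d # ds)"
      proof -
        obtain zs where zs: "q = (fst p, snd p @ zs)"
          using q(2) by (cases q) (auto simp: path_prefix_def prefix_def)
        then have "zs \<noteq> []" using \<open>q \<noteq> p\<close> by auto
        then show thesis using that zs by (cases zs) auto
      qed
      have "q \<in> FP F" using q(1) \<phi>_gis[OF e_gis] by (fastforce simp: Q_def)
      then have "d \<in> out_arcs F w"
        unfolding ds by (simp add: F.append_FP_iff F.Cons_FP_iff w_def)
      moreover have "out_arcs F w \<subseteq> (\<lambda>q. snd q ! length (snd p)) ` Q"
      proof
        fix d
        assume d: "d \<in> out_arcs F w"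
        obtain q where q: "q \<in> Q" "comparable (fst p, snd p @ [d]) q"
          using Q_comparable snoc_FP[OF d] by blast
        have "path_prefix (fst p, snd p @ [d]) q"
          using q(2) Q_not_prefix[OF q(1) Pp]
          by (cases q) (auto simp: comparable_def path_prefix_def)
        then have "d = snd q ! length (snd p)" by (auto simp: path_prefix_def prefix_def)
        then show "d \<in> (\<lambda>q. snd q ! length (snd p)) ` Q" using q(1) by blast
      qed
      then have "finite (out_arcs F w)" using finite_Q by (metis finite_surj)
      ultimately show ?thesis using w unfolding reg_def by blast
    qed
    \<comment> \<open>These mutually inverse elements link the idempotents at \<open>p\<close> and
      \<open>w\<close>. Conjugation by their images moves \<open>t\<close> below
      \<open>\<psi>(w,w)\<close>, where regularity of \<open>\<psi>\<close> applies.\<close>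
    define a :: "('w, 'f) gis" where "a = Some (p, vpath w)"
    define b :: "('w, 'f) gis" where "b = Some (vpath w, p)"
    have gis: "a \<in> gis F" "b \<in> gis F" "idem p \<in> gis F" "idem (vpath w) \<in> gis F"
      using p(1) w by (simp_all add: a_def b_def F.Some_gis_iff F.vpath_FP) (simp_all add: w_def vpath_def)
    have "a \<odot> b = idem p" "b \<odot> a = idem (vpath w)"
      by (simp_all add: a_def b_def idem_def pmult_def)
    then have ab: "\<psi> a \<odot> \<psi> b = \<psi> (idem p)" and ba: "\<psi> b \<odot> \<psi> a = \<psi> (idem (vpath w))"
      using \<psi>_mult[OF gis(1,2)] \<psi>_mult[OF gis(2,1)] by simp_all
    have idem_p: "\<psi> (idem p) \<odot> \<psi> (idem p) = \<psi> (idem p)"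
      using \<psi>_mult[OF gis(3,3)] by simp
    have "a \<odot> idem (vpath w) = a" "idem p \<odot> a = a"
      by (simp_all add: a_def idem_def pmult_def)
    then have aw: "\<psi> a \<odot> \<psi> (idem (vpath w)) = \<psi> a" and pa: "\<psi> (idem p) \<odot> \<psi> a = \<psi> a"
      using \<psi>_mult[OF gis(1,4)] \<psi>_mult[OF gis(3,1)] by simp_all
    have tp: "t \<odot> \<psi> (idem p) = \<psi> (idem p) \<odot> t"
      using idempotents_commute t(1) idem_p by blast
    define s where "s = \<psi> b \<odot> t \<odot> \<psi> a"
    have s_idem: "s \<odot> s = s"
    proof -
      have "s \<odot> s = \<psi> b \<odot> t \<odot> (\<psi> a \<odot> \<psi> b) \<odot> t \<odot> \<psi> a" by (simp add: s_def pmult_assoc)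
      also have "\<dots> = \<psi> b \<odot> (t \<odot> \<psi> (idem p)) \<odot> t \<odot> \<psi> a" by (simp add: ab pmult_assoc)
      also have "\<dots> = \<psi> b \<odot> (\<psi> (idem p) \<odot> t) \<odot> t \<odot> \<psi> a" by (simp only: tp)
      also have "\<dots> = \<psi> b \<odot> (\<psi> (idem p) \<odot> (t \<odot> t)) \<odot> \<psi> a" by (simp only: pmult_assoc)
      also have "\<dots> = \<psi> b \<odot> (t \<odot> \<psi> (idem p)) \<odot> \<psi> a" by (simp only: t tp)
      also have "\<dots> = s" by (simp add: pmult_assoc pa s_def)
      finally show ?thesis .
    qed
    have "s \<noteq> None"
    proof
      assume "s = None"
      \<comment> \<open>Conjugating back recovers \<open>t \<odot> \<psi>(p,p)\<close>, which is
        nonzero by the choice of \<open>p\<close>.\<close>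
      then have "\<psi> a \<odot> s \<odot> \<psi> b = None" by simp
      then have "\<psi> (idem p) \<odot> t \<odot> \<psi> (idem p) = None" by (simp add: s_def pmult_assoc flip: ab)
      then have "t \<odot> (\<psi> (idem p) \<odot> \<psi> (idem p)) = None" by (simp only: tp[symmetric] pmult_assoc)
      then show False using p(3) idem_p by simp
    qed
    then obtain x where x: "s = idem x" using idempotent_cases[OF s_idem] by blast
    have "s \<in> gis G" unfolding s_def using \<psi>_gis gis t(3) by (simp add: G.pmult_gis)
    then have "x \<in> FP G" by (simp add: x)
    moreover have "s \<odot> \<psi> (idem (vpath w)) = s" by (simp add: s_def pmult_assoc aw)
    ultimately obtain d where d: "d \<in> out_arcs F w" "s \<odot> \<psi> (idem (epath F d)) \<noteq> None"
      using \<psi>_reg[OF \<open>w \<in> reg F\<close>] x by blast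
    let ?p' = "(fst p, snd p @ [d])" and ?d = "idem (epath F d)"
    have d_gis: "?d \<in> gis F" using d(1) by (simp add: F.epath_FP)
    \<comment> \<open>The same conjugation carries the edge \<open>d\<close> at \<open>w\<close> to
      the one-edge extension of \<open>p\<close>.\<close>
    have "a \<odot> ?d \<odot> b = idem ?p'"
      using d(1) by (simp add: a_def b_def idem_def pmult_def epath_def vpath_def path_prefix_def)
    then have p': "\<psi> (idem ?p') = \<psi> a \<odot> \<psi> ?d \<odot> \<psi> b"
      using \<psi>_mult[OF gis(1) d_gis] \<psi>_mult[OF F.pmult_gis[OF gis(1) d_gis] gis(2)] by simp
    have "?d \<odot> idem (vpath w) = ?d"
      using d(1) by (simp add: path_prefix_def epath_def vpath_def)
    then have dw: "\<psi> ?d \<odot> \<psi> (idem (vpath w)) = \<psi> ?d" using \<psi>_mult[OF d_gis gis(4)] by (simp only:)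
    have "t \<odot> \<psi> (idem ?p') \<noteq> None"
    proof
      assume "t \<odot> \<psi> (idem ?p') = None"
      then have "\<psi> b \<odot> (t \<odot> \<psi> (idem ?p')) \<odot> \<psi> a = None" by simp
      then have "s \<odot> (\<psi> ?d \<odot> (\<psi> b \<odot> \<psi> a)) = None" by (simp add: p' s_def pmult_assoc)
      then show False using d(2) by (simp add: ba dw)
    qed
    then have "P ?p'" using snoc_FP[OF d(1)] by (simp add: P_def)
    then show False using max by fastforce
  qed
  ultimately show ?thesis using wf by (auto simp: REG_hom_iff)
qed

section \<open>Identities, functoriality and faithfulness\<close>

lemma RMIPG_hom_id:
  assumes "wf_digraph E"
  shows "restrict (\<lambda>p. p) (FP E) \<in> RMIPG_hom E E"
proof -
  interpret wf_digraph E by fact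
  define i where "i = restrict (\<lambda>p. p) (FP E)"
  have i: "i p = p" if "p \<in> FP E" for p using that by (simp add: i_def)
  have "path_hom E E i"
    unfolding path_hom_def
  proof (intro conjI ballI impI)
    show "i \<in> FP E \<rightarrow>\<^sub>E FP E" by (simp add: i_def)
    show "i ` vpath ` verts E \<subseteq> vpath ` verts E"
      by (simp add: image_subset_iff i vpath_FP)
  qed (simp_all add: i vpath_FP psrc_verts ptgt_verts pconc_FP)
  moreover have "monotonic E E i"
    unfolding monotonic_def
  proof (intro ballI impI)
    fix e e'
    assume "e \<in> arcs E" "e' \<in> arcs E" "path_le E (i (epath E e)) (i (epath E e'))"
    then have "path_prefix (epath E e) (epath E e')" by (simp add: i epath_FP path_le_iff)
    then show "e = e'" by (simp add: path_prefix_def epath_def)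
  qed
  moreover have "inj_on i (vpath ` verts E)"
    by (rule inj_onI) (metis i vpath_FP imageE)
  moreover have "branching E E i"
    unfolding branching_def
  proof (intro ballI allI impI)
    fix v e k d
    assume v: "v \<in> reg E" and e: "e \<in> out_arcs E v" and k: "k < length (snd (i (epath E e)))"
      and d: "d \<in> out_arcs E (tail E (snd (i (epath E e)) ! k))"
    have ie: "i (epath E e) = (v, [e])" using e by (simp add: i epath_FP) (simp add: epath_def)
    \<comment> \<open>The image is a single edge, so \<open>k = 0\<close> and \<open>d\<close>
      itself is the required edge.\<close>
    then have d': "d \<in> out_arcs E v" using d k e by simp
    then have "snd (i (epath E d)) = [d]" by (simp add: i epath_FP) (simp add: epath_def)
    then have "prefix (take k (snd (i (epath E e))) @ [d]) (snd (i (epath E d)))"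
      using ie k by simp
    then show "\<exists>e'\<in>out_arcs E v. prefix (take k (snd (i (epath E e))) @ [d]) (snd (i (epath E e')))"
      using d' by blast
  qed
  ultimately show ?thesis
    unfolding i_def[symmetric]
    using assms by (simp add: RMIPG_hom_iff mono_path_homomorphism_def path_homomorphism_def
        mono_path_homomorphism_axioms_def path_homomorphism_axioms_def)
qed

lemma phi_id: "phi E (restrict (\<lambda>p. p) (FP E)) = restrict (\<lambda>s. s) (gis E)"
  by (rule ext) (auto simp: phi_def gis_def)

lemma phi_compose:
  assumes "path_homomorphism E F f"
  shows "phi E (compose (FP E) g f) = compose (gis E) (phi F g) (phi E f)"
proof
  interpret path_homomorphism E F f by fact
  fix s
  show "phi E (compose (FP E) g f) s = compose (gis E) (phi F g) (phi E f) s"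
  proof (cases "s \<in> gis E")
    case True
    then have "phi E f s \<in> gis F" using phi_PiE by auto
    then show ?thesis using True
      by (cases s) (auto simp: compose_def phi_Some E.Some_gis_iff)
  qed (simp add: phi_def compose_def)
qed

text \<open>The value at \<open>(p,p)\<close> determines the image of \<open>p\<close>, and
  extensionality fixes both maps outside \<open>FP E\<close>.\<close>

lemma phi_inject:
  assumes "path_homomorphism E F f" "path_homomorphism E F g" "phi E f = phi E g"
  shows "f = g"
proof
  fix p
  have PiE: "f \<in> FP E \<rightarrow>\<^sub>E FP F" "g \<in> FP E \<rightarrow>\<^sub>E FP F"
    using assms(1,2) by (simp_all add: path_homomorphism_def path_homomorphism_axioms_def path_hom_def)
  show "f p = g p"
  proof (cases "p \<in> FP E")
    case True
    then show ?thesis using fun_cong[OF assms(3), of "idem p"] by (simp add: phi_idem)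
  next
    case False
    then show ?thesis using PiE[THEN PiE_arb] by simp
  qed
qed

lemma RMIPG_hom_PiE: "f \<in> RMIPG_hom E F \<Longrightarrow> f \<in> FP E \<rightarrow>\<^sub>E FP F"
  by (simp add: RMIPG_hom_def regular_path_hom_def path_hom_def)

lemma REG_hom_PiE: "\<phi> \<in> REG_hom E F \<Longrightarrow> \<phi> \<in> gis E \<rightarrow>\<^sub>E gis F"
  by (simp add: REG_hom_def ext_path_hom_def)

lemma compose_restrict_id_right: "f \<in> A \<rightarrow>\<^sub>E B \<Longrightarrow> compose A f (restrict (\<lambda>x. x) A) = f"
  by (rule ext) (auto simp: compose_def PiE_def extensional_def)

lemma compose_restrict_id_left: "f \<in> A \<rightarrow>\<^sub>E B \<Longrightarrow> compose A (restrict (\<lambda>x. x) B) f = f"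
  by (rule ext) (auto simp: compose_def PiE_def extensional_def)

lemma compose_PiE_assoc:
  "f \<in> A \<rightarrow>\<^sub>E B \<Longrightarrow> compose A h (compose A g f) = compose A (compose B h g) f"
  by (rule compose_assoc) auto

text \<open>The identity here is \<open>phi\<close> of the identity path homomorphism and inherits
  its regularity.\<close>

lemma REG_hom_id: "wf_digraph E \<Longrightarrow> restrict (\<lambda>s. s) (gis E) \<in> REG_hom E E"
  using phi_REG_hom[OF _ _ RMIPG_hom_id] by (simp add: phi_id)

lemma category_RMIPG: "category (RMIPG :: (('v, 'e) pre_digraph, _) cat)"
  apply (rule category.intro; unfold RMIPG_def cat.select_convs mem_Collect_eq)
  subgoal by (rule RMIPG_hom_id)
  subgoal by (rule RMIPG_hom_compose)
  subgoal by (rule compose_restrict_id_right[OF RMIPG_hom_PiE])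
  subgoal by (rule compose_restrict_id_left[OF RMIPG_hom_PiE])
  subgoal by (rule compose_PiE_assoc[OF RMIPG_hom_PiE])
  done

lemma category_REG: "category (REG :: (('v, 'e) pre_digraph, _) cat)"
  apply (rule category.intro; unfold REG_def cat.select_convs mem_Collect_eq)
  subgoal by (rule REG_hom_id)
  subgoal by (rule REG_hom_compose)
  subgoal by (rule compose_restrict_id_right[OF REG_hom_PiE])
  subgoal by (rule compose_restrict_id_left[OF REG_hom_PiE])
  subgoal by (rule compose_PiE_assoc[OF REG_hom_PiE])
  done

lemma RMIPG_hom_path_homomorphism:
  "wf_digraph E \<Longrightarrow> wf_digraph F \<Longrightarrow> f \<in> RMIPG_hom E F \<Longrightarrow> path_homomorphism E F f"
  by (simp add: RMIPG_hom_iff mono_path_homomorphism_def)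

theorem corollary4p8:
  shows "(\<forall>(E :: ('v, 'e) pre_digraph) (F :: ('w, 'f) pre_digraph) f.
            wf_digraph E \<longrightarrow> wf_digraph F \<longrightarrow> f \<in> RMIPG_hom E F \<longrightarrow> phi E f \<in> REG_hom E F) \<and>
         cat_functor (RMIPG :: (('a, 'b) pre_digraph, ('a, 'b) path \<Rightarrow> ('a, 'b) path) cat) REG
           (\<lambda>E. E) (\<lambda>E F f. phi E f) \<and>
         inj_on (\<lambda>E. E)
           (Obj (RMIPG :: (('a, 'b) pre_digraph, ('a, 'b) path \<Rightarrow> ('a, 'b) path) cat)) \<and>
         faithful (RMIPG :: (('a, 'b) pre_digraph, ('a, 'b) path \<Rightarrow> ('a, 'b) path) cat)
           (\<lambda>E F f. phi E f)"
proof (intro conjI allI impI)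
  show "phi E f \<in> REG_hom E F" if "wf_digraph E" "wf_digraph F" "f \<in> RMIPG_hom E F"
    for E :: "('v, 'e) pre_digraph" and F :: "('w, 'f) pre_digraph" and f
    using that by (rule phi_REG_hom)
  show "cat_functor (RMIPG :: (('a, 'b) pre_digraph, ('a, 'b) path \<Rightarrow> ('a, 'b) path) cat) REG
      (\<lambda>E. E) (\<lambda>E F f. phi E f)"
    by (intro cat_functor.intro category_RMIPG category_REG cat_functor_axioms.intro;
        unfold RMIPG_def REG_def cat.select_convs mem_Collect_eq)
      (assumption | rule phi_REG_hom phi_id phi_compose RMIPG_hom_path_homomorphism)+
  show "inj_on (\<lambda>E. E) (Obj (RMIPG :: (('a, 'b) pre_digraph, ('a, 'b) path \<Rightarrow> ('a, 'b) path) cat))"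
    by simp
  show "faithful (RMIPG :: (('a, 'b) pre_digraph, ('a, 'b) path \<Rightarrow> ('a, 'b) path) cat)
      (\<lambda>E F f. phi E f)"
    unfolding faithful_def RMIPG_def cat.select_convs mem_Collect_eq
    using phi_inject RMIPG_hom_path_homomorphism by (intro ballI inj_onI) blast
qed

end
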